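(* Let $G=(V,E)$ be a graph with positive edge lengths, $U\subseteq V$ its set of rankee nodes, $k\ge1$ an integer, and consider the batched (multithreaded) Pruned Dijkstra algorithm for computing all-distances sketches with parameter $k$, where $r$ is a uniformly random permutation order of $U$. For a parameter $\mu>0$, consider the partition of the searches into batches so that the $j$th batch ($j\ge1$) ends at the node in position $\lceil(1+\mu)^{j-1}k\rceil$ in the sorted order of $U$ by increasing $r(v)$. Then the expected overhead $h$ satisfies $$h\le \frac{\mu}{\ln(1+\mu)}-1 .$$
   Context: $d_{ij}$ denotes shortest-path distance from $i$ to $j$ in $G$; $G^T$ is the transposed graph (edges reversed). The values $r(u)$, $u\in U$, give the position of $u$ in a uniformly random permutation of $U$ (divided by $|U|$). All-distances sketch: for $v\in V$, $\mathrm{ADS}(v)$ is the set of entries $(j,d_{vj})$ for rankees $j$ such that $r(j)$ is at most the $k$-th smallest $r$ value among $\{h\in U: d_{vh}\le d_{vj}\}$ (with the $k$-th smallest value being the supremum of the range of $r$ if there are fewer than $k$ elements). Threshold: at any point, $\Delta(v)$ is the $k$-th smallest distance among entries currently in $\mathrm{ADS}(v)$ ($+\infty$ if fewer than $k$ entries), and $*(v)$ is the bit indicating whether the $(k+1)$-th smallest distance equals the $k$-th smallest. The prune condition for $(u,v)$ is: $d_{vu}>\Delta(v)$, or $d_{vu}=\Delta(v)$ and $*(v)$. Batched algorithm: the rankees, sorted by increasing $r$, are partitioned into consecutive batches (the last batch is truncated at $|U|$). In each batch, for each rankee $u$ in the batch, a Dijkstra search from $u$ on $G^T$ is run; when a node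 $v$ is scanned, if the prune condition holds with respect to the values $(\Delta(v),*(v))$ as they were at the beginning of the batch, the search is pruned at $v$, and otherwise $(u,d_{vu})$ is added to a set of proposed entries $PE(v)$. At the end of the batch, for each $v$, the entries $(u,d_{vu})$ of $PE(v)$ are processed in increasing order of $r(u)$: an entry is inserted into $\mathrm{ADS}(v)$ (updating $\Delta(v)$, $*(v)$) if the prune condition, with respect to the current values, does not hold, and is discarded otherwise. Overhead: the ratio of the expected number of discarded entries to the expected number of ADS entries, per node.
   Formalization: The bound is proved for each node v under the added assumption that no two rankees reachable from v are at the same distance from v; with ties it fails (k=1, μ=9, v with length-1 arcs to ten rankees gives overhead at least 4, while the bound is below 3). *)

theory Defs
  imports
    "HOL-Probability.Probability"
    "HOL-Combinatorics.Multiset_Permutations"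
    "Graph_Theory.Shortest_Path"
begin

text \<open>A directed graph is a \<^typ>\<open>('a, 'b) pre_digraph\<close> with arc lengths \<open>c\<close>. An undirected graph is
  the case in which every arc also occurs reversed, with the same length. The shortest-path distance
  is the library's \<^const>\<open>wf_digraph.\<mu>\<close>; it is \<open>\<infinity>\<close> if there is no walk.\<close>

abbreviation sp_dist :: "('a, 'b) pre_digraph \<Rightarrow> ('b \<Rightarrow> real) \<Rightarrow> 'a \<Rightarrow> 'a \<Rightarrow> ereal" where
  "sp_dist G c i j \<equiv> wf_digraph.\<mu> G c i j"

definition transpose_graph :: "('a, 'b) pre_digraph \<Rightarrow> ('a, 'b) pre_digraph" where
  "transpose_graph G = G\<lparr>tail := head G, head := tail G\<rparr>"

text \<open>The \<open>k\<close>-th smallest element counted with multiplicity (\<open>k \<ge> 1\<close>), or \<open>dflt\<close> if there are fewer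
  than \<open>k\<close> elements.\<close>

definition kth_smallest :: "nat \<Rightarrow> 'x::linorder \<Rightarrow> 'x multiset \<Rightarrow> 'x" where
  "kth_smallest k dflt M = (if k \<le> size M then sorted_list_of_multiset M ! (k - 1) else dflt)"


section \<open>All-distances sketches\<close>

text \<open>A permutation of the rankees is the list of the rankees in increasing order of \<open>r\<close>;
  positions are counted from 1.\<close>

definition rank_val :: "'a list \<Rightarrow> 'a \<Rightarrow> real" where
  "rank_val xs u = real (Suc (length (takeWhile (\<lambda>w. w \<noteq> u) xs))) / real (length xs)"

type_synonym 'a sketch = "('a \<times> ereal) set"

text \<open>Only rankees reachable from \<open>v\<close> have entries in the sketch of \<open>v\<close>.\<close>

definition ADS ::
  "('a, 'b) pre_digraph \<Rightarrow> ('b \<Rightarrow> real) \<Rightarrow> 'a set \<Rightarrow> nat \<Rightarrow> ('a \<Rightarrow> real) \<Rightarrow> 'a \<Rightarrow> 'a sketch" where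
  "ADS G c U k r v =
     {(j, sp_dist G c v j) | j. j \<in> U \<and> sp_dist G c v j < \<infinity> \<and>
        r j \<le> kth_smallest k (SUP u\<in>U. r u)
                (image_mset r (mset_set {h \<in> U. sp_dist G c v h \<le> sp_dist G c v j}))}"


section \<open>The prune condition\<close>

definition entry_dists :: "'a sketch \<Rightarrow> ereal multiset" where
  "entry_dists A = image_mset snd (mset_set A)"

definition threshold :: "nat \<Rightarrow> 'a sketch \<Rightarrow> ereal" where
  "threshold k A = kth_smallest k \<infinity> (entry_dists A)"

definition star_bit :: "nat \<Rightarrow> 'a sketch \<Rightarrow> bool" where
  "star_bit k A \<longleftrightarrow> Suc k \<le> size (entry_dists A) \<and>
     kth_smallest (Suc k) \<infinity> (entry_dists A) = kth_smallest k \<infinity> (entry_dists A)"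

definition prune :: "nat \<Rightarrow> 'a sketch \<Rightarrow> ereal \<Rightarrow> bool" where
  "prune k A d \<longleftrightarrow> d > threshold k A \<or> (d = threshold k A \<and> star_bit k A)"


section \<open>Pruned Dijkstra search\<close>

text \<open>The state is \<open>(D, S, P)\<close>: tentative distances from the source, the set of scanned nodes, and
  the set of pairs \<open>(w, D w)\<close> for the nodes \<open>w\<close> that were scanned without being pruned. The test
  \<open>pr w d\<close> is evaluated at the distance \<open>d\<close> found by the search; the search is never given the exact
  shortest-path distances. The infimum over parallel arcs is \<open>\<infinity>\<close> if there is no arc from
  \<open>w\<close> to \<open>x\<close>. A node of minimal tentative distance is chosen arbitrarily.\<close>

definition scan_step ::
  "('a, 'b) pre_digraph \<Rightarrow> ('b \<Rightarrow> real) \<Rightarrow> ('a \<Rightarrow> ereal \<Rightarrow> bool) \<Rightarrow>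
   ('a \<Rightarrow> ereal) \<times> 'a set \<times> ('a \<times> ereal) set \<Rightarrow> ('a \<Rightarrow> ereal) \<times> 'a set \<times> ('a \<times> ereal) set" where
  "scan_step H c pr = (\<lambda>(D, S, P).
     let F = {w \<in> verts H. w \<notin> S \<and> D w < \<infinity>} in
     if F = {} then (D, S, P)
     else let w = arg_min_on D F in
       if pr w (D w) then (D, insert w S, P)
       else ((\<lambda>x. min (D x) (INF a\<in>{a \<in> arcs H. tail H a = w \<and> head H a = x}. D w + ereal (c a))),
             insert w S, insert (w, D w) P))"

text \<open>Each step scans one node, so \<^term>\<open>card (verts H)\<close> steps exhaust the queue.\<close>

definition pruned_search ::
  "('a, 'b) pre_digraph \<Rightarrow> ('b \<Rightarrow> real) \<Rightarrow> ('a \<Rightarrow> ereal \<Rightarrow> bool) \<Rightarrow> 'a \<Rightarrow> ('a \<times> ereal) set" where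
  "pruned_search H c pr u =
     snd (snd ((scan_step H c pr ^^ card (verts H)) ((\<lambda>x. if x = u then 0 else \<infinity>), {}, {})))"


section \<open>The batched algorithm\<close>

text \<open>Per node: the sketch built so far, and the entries that were proposed and then discarded.\<close>

type_synonym 'a batch_state = "'a \<Rightarrow> 'a sketch \<times> 'a sketch"

text \<open>The entries proposed to \<open>v\<close> during the batch \<open>b\<close>, in increasing order of \<open>r\<close> (the order of \<open>b\<close>).
  All searches of the batch prune with respect to the state \<open>st\<close> at the beginning of the batch.\<close>

definition proposed ::
  "('a, 'b) pre_digraph \<Rightarrow> ('b \<Rightarrow> real) \<Rightarrow> nat \<Rightarrow> 'a batch_state \<Rightarrow> 'a list \<Rightarrow> 'a \<Rightarrow> ('a \<times> ereal) list" where
  "proposed G c k st b v =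
     [(u, THE d. (v, d) \<in> pruned_search (transpose_graph G) c (\<lambda>w. prune k (fst (st w))) u).
        u \<leftarrow> b, v \<in> fst ` pruned_search (transpose_graph G) c (\<lambda>w. prune k (fst (st w))) u]"

definition insert_entry :: "nat \<Rightarrow> 'a sketch \<times> 'a sketch \<Rightarrow> 'a \<times> ereal \<Rightarrow> 'a sketch \<times> 'a sketch" where
  "insert_entry k = (\<lambda>(A, X) e.
     if prune k A (snd e) then (A, insert e X) else (insert e A, X))"

definition run_batch ::
  "('a, 'b) pre_digraph \<Rightarrow> ('b \<Rightarrow> real) \<Rightarrow> nat \<Rightarrow> 'a batch_state \<Rightarrow> 'a list \<Rightarrow> 'a batch_state" where
  "run_batch G c k st b = (\<lambda>v. foldl (insert_entry k) (st v) (proposed G c k st b v))"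

definition run_batches ::
  "('a, 'b) pre_digraph \<Rightarrow> ('b \<Rightarrow> real) \<Rightarrow> nat \<Rightarrow> 'a list list \<Rightarrow> 'a batch_state" where
  "run_batches G c k bs = foldl (run_batch G c k) (\<lambda>v. ({}, {})) bs"

text \<open>Position of the last rankee of the \<open>j\<close>-th batch, truncated at the number \<open>n\<close> of rankees.
  Consecutive values may coincide for small \<open>mu\<close>; the corresponding batch is then empty.\<close>

definition batch_end :: "real \<Rightarrow> nat \<Rightarrow> nat \<Rightarrow> nat \<Rightarrow> nat" where
  "batch_end mu k n j = (if j = 0 then 0 else min n (nat \<lceil>(1 + mu) ^ (j - 1) * real k\<rceil>))"

definition geometric_batches :: "real \<Rightarrow> nat \<Rightarrow> 'a list \<Rightarrow> 'a list list" where
  "geometric_batches mu k xs =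
     (let n = length xs
      in map (\<lambda>j. drop (batch_end mu k n (j - 1)) (take (batch_end mu k n j) xs))
           [1..<Suc (LEAST J. batch_end mu k n J = n)])"

definition discarded ::
  "('a, 'b) pre_digraph \<Rightarrow> ('b \<Rightarrow> real) \<Rightarrow> nat \<Rightarrow> real \<Rightarrow> 'a list \<Rightarrow> 'a \<Rightarrow> 'a sketch" where
  "discarded G c k mu xs v = snd (run_batches G c k (geometric_batches mu k xs) v)"


section \<open>Overhead\<close>

definition overhead ::
  "('a, 'b) pre_digraph \<Rightarrow> ('b \<Rightarrow> real) \<Rightarrow> 'a set \<Rightarrow> nat \<Rightarrow> real \<Rightarrow> 'a \<Rightarrow> real" where
  "overhead G c U k mu v =
     measure_pmf.expectation (pmf_of_set (permutations_of_set U))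
       (\<lambda>xs. real (card (discarded G c k mu xs v))) /
     measure_pmf.expectation (pmf_of_set (permutations_of_set U))
       (\<lambda>xs. real (card (ADS G c U k (rank_val xs) v)))"

text \<open>No two rankees reachable from \<open>v\<close> are at the same distance from \<open>v\<close>. The bound fails with ties:
  for \<open>k = 1\<close>, \<open>mu = 9\<close> and a non-rankee \<open>v\<close> whose only arcs have length 1 and lead to ten rankees, the
  second batch always proposes nine entries and discards eight, while \<open>ADS(v)\<close> has one entry
  (and the algorithm, which inserts at \<open>d = \<Delta>(v)\<close> if the bit is unset, keeps two); the bound is
  below 3.\<close>

definition distinct_dists :: "('a, 'b) pre_digraph \<Rightarrow> ('b \<Rightarrow> real) \<Rightarrow> 'a set \<Rightarrow> 'a \<Rightarrow> bool" where
  "distinct_dists G c U v \<longleftrightarrow> inj_on (sp_dist G c v) {u \<in> U. sp_dist G c v u < \<infinity>}"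

end

theory Submission
  imports Defs
begin

text \<open>Fix a node \<open>v\<close>. When distances from \<open>v\<close> are distinct, the sketch of \<open>v\<close> after
  processing a prefix of the permutation consists of those rankees which, at their turn, had fewer than
  \<open>k\<close> predecessors closer to \<open>v\<close>; a rankee in a batch starting at position \<open>s\<close> is proposed
  iff it has fewer than \<open>k\<close> closer rankees among the first \<open>s\<close>. By symmetry, the
  rankee at position \<open>i \<ge> s\<close> is proposed with probability \<open>a (s + 1) / (s + 1)\<close> and inserted with probability
  \<open>a (i + 1) / (i + 1)\<close>, where \<open>a t\<close> is the expected minimum of \<open>k\<close> and the number of
  rankees reachable from \<open>v\<close> among the first \<open>t\<close>. As \<open>a\<close> is nondecreasing, the ratio of proposed to
  inserted entries in the batch with positions \<open>s, \<dots>, s + p - 1\<close> is at most \<open>p / (s + 1)\<close> divided by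
  \<open>1 / (s + 1) + \<dots> + 1 / (s + p)\<close>. As \<open>p - 1 < mu * s\<close>, this is at most \<open>mu / ln (1 + mu)\<close>.
  The first batch has at most \<open>k\<close> rankees, so nothing is discarded there.\<close>

section \<open>The overhead of a single batch\<close>

text \<open>By concavity of \<open>ln\<close> on the chord from \<open>1\<close> to
  \<open>1 + b\<close>, with \<open>ln 1 = 0\<close>: the quotient \<open>ln (1 + x) / x\<close> is
  nonincreasing.\<close>

lemma ln_add_one_mult_le:
  fixes a b :: real
  assumes "0 < a" "a \<le> b"
  shows "a * ln (1 + b) \<le> b * ln (1 + a)"
proof -
  have conc: "concave_on {0<..} (ln :: real \<Rightarrow> real)"
    by (rule ln_concave)
  define t where "t = a / b"
  have t: "0 \<le> t" "t \<le> 1" using assms by (auto simp: t_def)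
  have "(1 - t) * ln 1 + t * ln (1 + b) \<le> ln ((1 - t) *\<^sub>R 1 + t *\<^sub>R (1 + b))"
    using assms t by (intro concave_onD[OF conc]) auto
  also have "(1 - t) *\<^sub>R 1 + t *\<^sub>R (1 + b) = 1 + a"
    using assms by (simp add: t_def field_simps)
  finally have "t * ln (1 + b) \<le> ln (1 + a)" by simp
  then show ?thesis using assms by (simp add: t_def field_simps)
qed

text \<open>Pair term \<open>i\<close> with term \<open>q - i\<close>. The two denominators have the
  constant sum \<open>2 * s + q\<close>, and their product is smallest for the two endpoints, so
  each pair is at most the endpoint pair.\<close>

lemma sum_inverse_le_endpoints:
  fixes s :: real
  assumes "0 < s"
  shows "(\<Sum>i\<le>q. 1 / (s + real i)) \<le> real (q + 1) * (1 / s + 1 / (s + real q)) / 2"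
proof -
  have pair: "1 / (s + real i) + 1 / (s + real (q - i)) \<le> 1 / s + 1 / (s + real q)"
    if "i \<le> q" for i
  proof -
    define a b where "a = real i" and "b = real (q - i)"
    have ab: "real q = a + b" "0 \<le> a" "0 \<le> b" using that by (auto simp: a_def b_def)
    have *: "1 / x + 1 / y = (x + y) / (x * y)" if "0 < x" "0 < y" for x y :: real
      using that by (simp add: field_simps)
    have "1 / (s + a) + 1 / (s + b) = (2 * s + a + b) / ((s + a) * (s + b))"
      using assms ab by (subst *) auto
    also have "\<dots> \<le> (2 * s + a + b) / (s * (s + (a + b)))"
    proof (intro divide_left_mono)
      show "s * (s + (a + b)) \<le> (s + a) * (s + b)" using ab by (simp add: algebra_simps)
      show "0 < (s + a) * (s + b) * (s * (s + (a + b)))"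
        using assms ab by (intro mult_pos_pos) auto
    qed (use assms ab in auto)
    also have "\<dots> = 1 / s + 1 / (s + (a + b))"
      using assms ab by (subst *) auto
    finally show ?thesis by (simp only: ab(1) flip: a_def b_def)
  qed
  have flip: "(\<Sum>i\<le>q. 1 / (s + real (q - i))) = (\<Sum>i\<le>q. 1 / (s + real i))"
    by (rule sum.reindex_bij_witness[of _ "\<lambda>i. q - i" "\<lambda>i. q - i"]) auto
  have "2 * (\<Sum>i\<le>q. 1 / (s + real i)) = (\<Sum>i\<le>q. 1 / (s + real i) + 1 / (s + real (q - i)))"
    by (simp only: sum.distrib flip mult_2)
  also have "\<dots> \<le> (\<Sum>i\<le>q. 1 / s + 1 / (s + real q))"
    by (intro sum_mono pair) auto
  finally show ?thesis by simp
qed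

text \<open>The right side is the composite trapezoidal sum with unit steps. Since
  \<open>1 / x\<close> is convex, each trapezoid exceeds the integral over its interval; the
  logarithms telescope.\<close>

lemma ln_le_trapezoid:
  fixes s :: real
  assumes "0 < s"
  shows "ln (s + real q) - ln s \<le> (\<Sum>i\<le>q. 1 / (s + real i)) - (1 / s + 1 / (s + real q)) / 2"
proof (induction q)
  case (Suc q)
  have "ln (s + real q + 1) - ln (s + real q)
      \<le> 1 * (inverse (s + real q) + inverse (s + real q + 1)) / 2"
    using assms by (intro ln_inverse_approx_le) auto
  with Suc.IH show ?case by (simp add: field_simps)
qed simp

text \<open>The trapezoidal rule overestimates \<open>\<integral> 1/x\<close>, and it is at most the plain average of
  the sampled values, because these are at most the average of the two endpoints.\<close>

lemma batch_overhead:
  assumes "1 \<le> s" "0 < mu" "real p < mu * real s + 1"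
  shows "real p / real (s + 1) \<le> mu / ln (1 + mu) * (\<Sum>i\<in>{s..<s + p}. 1 / real (i + 1))"
proof -
  have lnpos: "0 < ln (1 + mu)" using assms by simp
  define R where "R = (\<Sum>i\<in>{s..<s + p}. 1 / real (i + 1))"
  have R: "R = (\<Sum>i<p. 1 / real (s + i + 1))"
    unfolding R_def by (rule sum.reindex_bij_witness[of _ "\<lambda>i. s + i" "\<lambda>i. i - s"]) auto
  have "real p / real (s + 1) * ln (1 + mu) \<le> mu * R"
  proof (cases p)
    case 0
    then show ?thesis by (simp add: R)
  next
    case (Suc q)
    show ?thesis
    proof (cases "q = 0")
      \<comment> \<open>For \<open>q = 0\<close> the quotient \<open>a\<close> used below would be 0
        and could not be cancelled at the end.\<close>
      case True
      have "ln (1 + mu) \<le> mu" using assms by (intro ln_add_one_self_le_self) auto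
      then show ?thesis using Suc True by (simp add: R divide_right_mono)
    next
      case False
      \<comment> \<open>\<open>1 + a\<close> is the ratio of the endpoints \<open>s + q\<close> and
        \<open>s\<close>, so \<open>ln (1 + a)\<close> is the integral to compare with;
        \<open>q < mu * s\<close> gives \<open>a \<le> mu\<close>. \<open>S\<close> samples at
        \<open>s, ..., s + q\<close>, whereas \<open>R\<close> samples one unit further
        right.\<close>
      define a where "a = real q / real s"
      define e where "e = 1 / real s + 1 / (real s + real q)"
      define S where "S = (\<Sum>i\<le>q. 1 / (real s + real i))"
      have a: "0 < a" "a \<le> mu" using False assms Suc by (auto simp: a_def field_simps)
      have "S \<le> real p * e / 2"
        unfolding S_def e_def using sum_inverse_le_endpoints[of "real s" q] assms Suc by simp
      moreover have "ln (1 + a) = ln (real s + real q) - ln (real s)"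
      proof -
        have "1 + a = (real s + real q) / real s" using assms(1) by (simp add: a_def field_simps)
        then show ?thesis using assms(1) by (simp add: ln_div)
      qed
      then have "ln (1 + a) \<le> S - e / 2"
        unfolding S_def e_def using ln_le_trapezoid[of "real s" q] assms by simp
      then have "real p * ln (1 + a) \<le> real p * (S - e / 2)"
        by (intro mult_left_mono) auto
      \<comment> \<open>The endpoint term \<open>p * e / 2\<close> is at least \<open>S\<close>,
        which removes \<open>e\<close>.\<close>
      ultimately have "real p * ln (1 + a) \<le> real p * S - S"
        by (simp add: right_diff_distrib)
      then have avg: "real p * ln (1 + a) \<le> real q * S"
        using Suc by (simp add: algebra_simps)
      \<comment> \<open>Shifting the sample points by one unit costs at most the factor
        \<open>(s + 1) / s\<close>: termwise, the cross products differ by \<open>i\<close>.\<close>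
      have "S / real (s + 1) \<le> R / real s"
        unfolding S_def R sum_divide_distrib Suc lessThan_Suc_atMost
      proof (intro sum_mono)
        fix i assume "i \<in> {..q}"
        have "real (s + i + 1) * real s \<le> (real s + real i) * real (s + 1)"
          by (simp add: algebra_simps)
        then have "1 / ((real s + real i) * real (s + 1)) \<le> 1 / (real (s + i + 1) * real s)"
          using assms(1) by (intro divide_left_mono mult_pos_pos) auto
        then show "1 / (real s + real i) / real (s + 1) \<le> 1 / real (s + i + 1) / real s"
          by (simp only: divide_divide_eq_left)
      qed
      then have "real q * S / real (s + 1) \<le> a * R"
        using mult_left_mono[of "S / real (s + 1)" "R / real s" "real q"] by (simp add: a_def)
      moreover have "real p * ln (1 + a) / real (s + 1) \<le> real q * S / real (s + 1)"
        using avg by (intro divide_right_mono) auto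
      ultimately have "real p / real (s + 1) * ln (1 + a) \<le> a * R"
        by (simp only: times_divide_eq_left)
      then have "mu * (real p / real (s + 1) * ln (1 + a)) \<le> mu * (a * R)"
        using assms by (intro mult_left_mono) auto
      \<comment> \<open>Monotonicity of \<open>ln (1 + x) / x\<close> replaces \<open>a\<close> by
        \<open>mu\<close>; the positive factor \<open>a\<close> then cancels.\<close>
      moreover have "real p / real (s + 1) * (a * ln (1 + mu)) \<le> real p / real (s + 1) * (mu * ln (1 + a))"
        by (intro mult_left_mono ln_add_one_mult_le a) auto
      ultimately have "a * (real p / real (s + 1) * ln (1 + mu)) \<le> a * (mu * R)"
        by (simp add: mult_ac)
      then show ?thesis using a(1) by (rule mult_left_le_imp_le)
    qed
  qed
  then show ?thesis using lnpos by (simp add: R_def field_simps)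
qed

section \<open>Sums over permutations\<close>

lemma swap_mem_permutations_of_set:
  assumes "xs \<in> permutations_of_set U" "i < length xs" "j < length xs"
  shows "xs[i := xs ! j, j := xs ! i] \<in> permutations_of_set U"
  using assms by (auto simp: permutations_of_set_def)

text \<open>Exchangeability of a uniformly random permutation: swapping two positions is an
  involution on the permutations of \<open>U\<close>.\<close>

lemma sum_permutations_swap:
  assumes "i < card U" "j < card U"
  shows "(\<Sum>xs\<in>permutations_of_set U. f (xs[i := xs ! j, j := xs ! i])) = (\<Sum>xs\<in>permutations_of_set U. f xs)"
proof -
  have len: "length xs = card U" if "xs \<in> permutations_of_set U" for xs
    using that by (rule length_finite_permutations_of_set)
  have invol: "xs[i := xs ! j, j := xs ! i, i := xs[i := xs ! j, j := xs ! i] ! j,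
      j := xs[i := xs ! j, j := xs ! i] ! i] = xs" if "xs \<in> permutations_of_set U" for xs
    using len[OF that] assms by (intro nth_equalityI) (auto simp: nth_list_update)
  have swap_mem: "xs[i := xs ! j, j := xs ! i] \<in> permutations_of_set U"
    if "xs \<in> permutations_of_set U" for xs
    using swap_mem_permutations_of_set[OF that] len[OF that] assms by simp
  show ?thesis
    by (rule sum.reindex_bij_witness[of _ "\<lambda>xs. xs[i := xs ! j, j := xs ! i]" "\<lambda>xs. xs[i := xs ! j, j := xs ! i]"])
      (rule invol swap_mem refl, assumption?)+
qed

text \<open>Positions \<open>i\<close> and \<open>s\<close> both lie outside the prefix of length
  \<open>s\<close>, so swapping them leaves that prefix unchanged.\<close>

lemma sum_permutations_nth_beyond:
  assumes "s \<le> i" "i < card U"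
  shows "(\<Sum>xs\<in>permutations_of_set U. f (set (take s xs)) (xs ! i)) =
    (\<Sum>xs\<in>permutations_of_set U. f (set (take s xs)) (xs ! s))"
proof -
  have "(\<Sum>xs\<in>permutations_of_set U. f (set (take s xs)) (xs ! i)) =
    (\<Sum>xs\<in>permutations_of_set U. f (set (take s (xs[s := xs ! i, i := xs ! s]))) (xs[s := xs ! i, i := xs ! s] ! s))"
    using assms by (intro sum.cong) (auto dest: length_finite_permutations_of_set simp: nth_list_update)
  also have "\<dots> = (\<Sum>xs\<in>permutations_of_set U. f (set (take s xs)) (xs ! s))"
    using assms by (intro sum_permutations_swap[where f = "\<lambda>xs. f (set (take s xs)) (xs ! s)"]) auto
  finally show ?thesis .
qed

text \<open>Swapping position \<open>s\<close> with some \<open>l \<le> s\<close> only rearranges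
  the prefix of length \<open>s + 1\<close>. Given the set of that prefix, each of its elements is
  therefore equally likely to come last.\<close>

lemma sum_permutations_nth_within:
  fixes f :: "'a set \<Rightarrow> 'a \<Rightarrow> real"
  assumes "s < card U"
  shows "real (s + 1) * (\<Sum>xs\<in>permutations_of_set U. f (set (take (Suc s) xs)) (xs ! s)) =
    (\<Sum>xs\<in>permutations_of_set U. \<Sum>u\<in>set (take (Suc s) xs). f (set (take (Suc s) xs)) u)"
proof -
  let ?P = "permutations_of_set U"
  have swap: "(\<Sum>xs\<in>?P. f (set (take (Suc s) xs)) (xs ! l)) = (\<Sum>xs\<in>?P. f (set (take (Suc s) xs)) (xs ! s))"
    if "l \<le> s" for l
  proof -
    have "set (take (Suc s) (xs[l := xs ! s, s := xs ! l])) = set (take (Suc s) xs)"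
      if "xs \<in> ?P" for xs
    proof -
      have "length xs = card U" using that by (rule length_finite_permutations_of_set)
      then have "set ((take (Suc s) xs)[l := take (Suc s) xs ! s, s := take (Suc s) xs ! l]) = set (take (Suc s) xs)"
        using assms \<open>l \<le> s\<close> by (intro set_swap) auto
      then show ?thesis using \<open>l \<le> s\<close> by (simp add: take_update_swap)
    qed
    then have "(\<Sum>xs\<in>?P. f (set (take (Suc s) xs)) (xs ! l)) =
      (\<Sum>xs\<in>?P. f (set (take (Suc s) (xs[l := xs ! s, s := xs ! l]))) (xs[l := xs ! s, s := xs ! l] ! s))"
      using assms that by (intro sum.cong) (auto dest: length_finite_permutations_of_set simp: nth_list_update)
    also have "\<dots> = (\<Sum>xs\<in>?P. f (set (take (Suc s) xs)) (xs ! s))"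
      using assms that by (intro sum_permutations_swap[where f = "\<lambda>xs. f (set (take (Suc s) xs)) (xs ! s)"]) auto
    finally show ?thesis .
  qed
  have "(\<Sum>xs\<in>?P. \<Sum>u\<in>set (take (Suc s) xs). f (set (take (Suc s) xs)) u) =
    (\<Sum>xs\<in>?P. \<Sum>l\<le>s. f (set (take (Suc s) xs)) (xs ! l))"
  proof (intro sum.cong refl)
    fix xs assume xs: "xs \<in> ?P"
    then have "length xs = card U" "distinct xs"
      by (auto dest: length_finite_permutations_of_set permutations_of_setD)
    then have "bij_betw (\<lambda>l. take (Suc s) xs ! l) {..s} (set (take (Suc s) xs))"
      using assms by (intro bij_betw_nth) (auto simp: lessThan_Suc_atMost)
    then have "bij_betw (\<lambda>l. xs ! l) {..s} (set (take (Suc s) xs))"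
      by (subst bij_betw_cong[where g = "\<lambda>l. take (Suc s) xs ! l"]) auto
    from sum.reindex_bij_betw[OF this, of "f (set (take (Suc s) xs))"]
    show "sum (f (set (take (Suc s) xs))) (set (take (Suc s) xs)) = (\<Sum>l\<le>s. f (set (take (Suc s) xs)) (xs ! l))"
      by simp
  qed
  also have "\<dots> = (\<Sum>l\<le>s. \<Sum>xs\<in>?P. f (set (take (Suc s) xs)) (xs ! l))"
    by (rule sum.swap)
  also have "\<dots> = real (s + 1) * (\<Sum>xs\<in>?P. f (set (take (Suc s) xs)) (xs ! s))"
    using sum.cong[OF refl swap, of "{..s}"] by simp
  finally show ?thesis by simp
qed

section \<open>Shortest-path distances\<close>

context fin_digraph
begin

lemma mu_attained:
  assumes "\<And>a. a \<in> arcs G \<Longrightarrow> 0 \<le> c a" "\<mu> c u w < \<infinity>"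
  obtains p where "awalk u p w" "\<mu> c u w = ereal (awalk_cost c p)"
proof -
  have "u \<rightarrow>\<^sup>* w" using assms(2) shortest_path_inf[of u w c] by auto
  from min_cost_awalk[OF this] assms(1) that show thesis by (auto simp: apath_def)
qed

lemma mu_nonneg:
  assumes "\<And>a. a \<in> arcs G \<Longrightarrow> 0 \<le> c a"
  shows "0 \<le> \<mu> c u w"
  unfolding \<mu>_def using assms by (auto intro!: INF_greatest pos_cost_pos_awalk_cost)

lemma mu_self:
  assumes "\<And>a. a \<in> arcs G \<Longrightarrow> 0 \<le> c a" "u \<in> verts G"
  shows "\<mu> c u u = 0"
proof (rule antisym)
  show "\<mu> c u u \<le> 0"
    using min_cost_le_walk_cost[of u "[]" u c] assms(2) by (simp add: awalk_Nil_iff zero_ereal_def)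
qed (use mu_nonneg assms in auto)

lemma mu_triangle:
  assumes "\<And>a. a \<in> arcs G \<Longrightarrow> 0 \<le> c a"
  shows "\<mu> c u x \<le> \<mu> c u w + \<mu> c w x"
proof (cases "\<mu> c u w < \<infinity> \<and> \<mu> c w x < \<infinity>")
  case True
  obtain p where "awalk u p w" "\<mu> c u w = ereal (awalk_cost c p)"
    by (rule mu_attained[of c u w]) (use assms True in auto)
  moreover obtain q where "awalk w q x" "\<mu> c w x = ereal (awalk_cost c q)"
    by (rule mu_attained[of c w x]) (use assms True in auto)
  ultimately show ?thesis using min_cost_le_walk_cost[of u "p @ q" x c] by simp
next
  case False
  then show ?thesis using mu_nonneg[of c, OF assms] by auto
qed

lemma mu_arc:
  assumes "\<And>a. a \<in> arcs G \<Longrightarrow> 0 \<le> c a" "a \<in> arcs G"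
  shows "\<mu> c (tail G a) x \<le> ereal (c a) + \<mu> c (head G a) x"
proof -
  have "\<mu> c (tail G a) x \<le> \<mu> c (tail G a) (head G a) + \<mu> c (head G a) x"
    by (rule mu_triangle[OF assms(1)])
  also have "\<mu> c (tail G a) (head G a) \<le> ereal (c a)"
    using min_cost_le_walk_cost[of "tail G a" "[a]" "head G a" c] assms by (simp add: awalk_simps)
  finally show ?thesis by (simp add: add_right_mono)
qed

text \<open>The first arc of a shortest walk; by \<open>mu_arc\<close>, the rest of the walk is
  again shortest. In the transposed graph this arc becomes the last arc of a shortest path from
  \<open>u\<close>.\<close>

lemma mu_first_arc:
  assumes "\<And>a. a \<in> arcs G \<Longrightarrow> 0 \<le> c a" "\<mu> c w u < \<infinity>" "w \<noteq> u"
  obtains a where "a \<in> arcs G" "tail G a = w" "\<mu> c w u = ereal (c a) + \<mu> c (head G a) u"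
proof -
  obtain p where p: "awalk w p u" "\<mu> c w u = ereal (awalk_cost c p)"
    using mu_attained[OF assms(1,2)] by metis
  with assms(3) obtain a q where q: "p = a # q"
    by (cases p) (auto simp: awalk_Nil_iff)
  then have a: "a \<in> arcs G" "tail G a = w" "awalk (head G a) q u"
    using p by (auto simp: awalk_Cons_iff)
  have "ereal (c a) + \<mu> c (head G a) u \<le> ereal (c a) + ereal (awalk_cost c q)"
    using min_cost_le_walk_cost[OF a(3), of c] by (intro add_left_mono)
  also have "\<dots> = \<mu> c w u" using p q by simp
  finally have "\<mu> c w u = ereal (c a) + \<mu> c (head G a) u"
    using mu_arc[of c, OF assms(1) a(1), of u] a(2) by (auto intro: antisym)
  with a that show thesis by auto
qed

end

section \<open>Pruned Dijkstra search\<close>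

text \<open>\<open>\<delta>\<close> stands for the exact distances from the source, and \<open>T\<close> for the nodes
  which the search is guaranteed to reach along unpruned shortest paths.\<close>

locale unpruned_region = wf_digraph H for H :: "('a, 'b) pre_digraph" +
  fixes c :: "'b \<Rightarrow> real" and pr :: "'a \<Rightarrow> ereal \<Rightarrow> bool" and u :: 'a
    and \<delta> :: "'a \<Rightarrow> ereal" and T :: "'a set"
  assumes finite_verts: "finite (verts H)"
    and pos: "\<And>a. a \<in> arcs H \<Longrightarrow> 0 < c a"
    and delta_source: "\<delta> u = 0"
    and delta_nonneg: "\<And>x. 0 \<le> \<delta> x"
    and delta_arc: "\<And>a. a \<in> arcs H \<Longrightarrow> \<delta> (head H a) \<le> \<delta> (tail H a) + ereal (c a)"
    and region_verts: "T \<subseteq> verts H"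
    and region_finite: "\<And>x. x \<in> T \<Longrightarrow> \<delta> x < \<infinity>"
    and region_unpruned: "\<And>x. x \<in> T \<Longrightarrow> \<not> pr x (\<delta> x)"
    and region_pred: "\<And>x. x \<in> T \<Longrightarrow> x \<noteq> u \<Longrightarrow>
      \<exists>a\<in>arcs H. head H a = x \<and> tail H a \<in> T \<and> \<delta> x = \<delta> (tail H a) + ereal (c a)"
begin

text \<open>Outside \<open>T\<close> pruning may cut off all shortest paths, so there
  \<open>D\<close> is only an upper estimate. On \<open>T\<close> scanned nodes are exact and their
  arcs relaxed. Injectivity of \<open>fst\<close> on \<open>P\<close> gives every node at most one
  recorded distance.\<close>

definition search_inv :: "('a \<Rightarrow> ereal) \<times> 'a set \<times> ('a \<times> ereal) set \<Rightarrow> bool" where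
  "search_inv = (\<lambda>(D, S, P). (\<forall>x. \<delta> x \<le> D x) \<and> D u \<le> 0 \<and> S \<subseteq> verts H \<and>
     (\<forall>w d. (w, d) \<in> P \<longrightarrow> w \<in> S \<and> \<delta> w \<le> d \<and> d < \<infinity> \<and> \<not> pr w d) \<and> inj_on fst P \<and>
     (\<forall>x\<in>T \<inter> S. (x, \<delta> x) \<in> P \<and> (\<forall>a\<in>arcs H. tail H a = x \<longrightarrow> D (head H a) \<le> \<delta> x + ereal (c a))))"

text \<open>Take \<open>y\<close> nearest to the source among the unscanned nodes of
  \<open>T\<close>. As arcs are positive, its predecessor in \<open>T\<close> is strictly nearer,
  hence scanned, and has already relaxed the arc to \<open>y\<close>.\<close>

lemma unscanned_exact:
  assumes inv: "search_inv (D, S, P)" and ne: "T - S \<noteq> {}"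
  obtains y where "y \<in> T - S" "D y = \<delta> y" "\<And>x. x \<in> T - S \<Longrightarrow> \<delta> y \<le> \<delta> x"
proof -
  have fin: "finite (T - S)" using finite_verts region_verts finite_subset by blast
  define y where "y = arg_min_on \<delta> (T - S)"
  have y: "y \<in> T - S" "\<And>x. x \<in> T - S \<Longrightarrow> \<delta> y \<le> \<delta> x"
    using arg_min_if_finite(1)[OF fin ne] arg_min_least[OF fin ne] by (auto simp: y_def)
  have "D y \<le> \<delta> y"
  proof (cases "y = u")
    case True
    then show ?thesis using inv delta_source by (simp add: search_inv_def)
  next
    case False
    then obtain a where a: "a \<in> arcs H" "head H a = y" "tail H a \<in> T" "\<delta> y = \<delta> (tail H a) + ereal (c a)"
      using region_pred y(1) by blast
    have "\<delta> (tail H a) < \<delta> y"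
      using a(4) pos[OF a(1)] region_finite[OF a(3)] delta_nonneg[of "tail H a"]
      by (cases "\<delta> (tail H a)") auto
    then have "tail H a \<in> S" using y(2) a(3) by (auto simp: not_le[symmetric])
    then show ?thesis using inv a by (auto simp: search_inv_def)
  qed
  moreover have "\<delta> y \<le> D y" using inv by (simp add: search_inv_def)
  ultimately show thesis using that y by (auto intro: antisym)
qed

lemma scan_step_idle:
  assumes "{w \<in> verts H. w \<notin> S \<and> D w < \<infinity>} = {}"
  shows "scan_step H c pr (D, S, P) = (D, S, P)"
  unfolding scan_step_def Let_def case_prod_conv assms by simp

lemma scan_step_scan:
  assumes "{w \<in> verts H. w \<notin> S \<and> D w < \<infinity>} \<noteq> {}"
    and "w = arg_min_on D {w \<in> verts H. w \<notin> S \<and> D w < \<infinity>}"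
  shows "scan_step H c pr (D, S, P) = (if pr w (D w) then (D, insert w S, P)
    else ((\<lambda>x. min (D x) (INF a\<in>{a \<in> arcs H. tail H a = w \<and> head H a = x}. D w + ereal (c a))),
          insert w S, insert (w, D w) P))"
  using assms(1) unfolding scan_step_def Let_def case_prod_conv assms(2)[symmetric] by (simp only: if_False)

lemma search_inv_init: "search_inv ((\<lambda>x. if x = u then 0 else \<infinity>), {}, {})"
  using delta_source by (simp add: search_inv_def)

lemma search_inv_step:
  assumes inv: "search_inv st"
  shows "search_inv (scan_step H c pr st)"
proof -
  obtain D S P where st: "st = (D, S, P)" by (cases st)
  define F where "F = {w \<in> verts H. w \<notin> S \<and> D w < \<infinity>}"
  show ?thesis
  proof (cases "F = {}")
    case True
    then show ?thesis using inv scan_step_idle by (simp add: st F_def)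
  next
    case False
    have finF: "finite F" using finite_verts by (auto simp: F_def)
    define w where "w = arg_min_on D F"
    note scan = scan_step_scan[OF False[unfolded F_def] w_def[unfolded F_def]]
    have wF: "w \<in> verts H" "w \<notin> S" "D w < \<infinity>"
      using arg_min_if_finite(1)[OF finF False] by (auto simp: F_def w_def)
    have wmin: "D w \<le> D x" if "x \<in> F" for x
      using arg_min_least[OF finF False that] by (simp add: w_def)
    have I: "\<And>x. \<delta> x \<le> D x" "D u \<le> 0" "S \<subseteq> verts H" "inj_on fst P"
      "\<And>x d. (x, d) \<in> P \<Longrightarrow> x \<in> S \<and> \<delta> x \<le> d \<and> d < \<infinity> \<and> \<not> pr x d"
      "\<And>x. x \<in> T \<Longrightarrow> x \<in> S \<Longrightarrow> (x, \<delta> x) \<in> P"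
      "\<And>a. a \<in> arcs H \<Longrightarrow> tail H a \<in> T \<Longrightarrow> tail H a \<in> S \<Longrightarrow> D (head H a) \<le> \<delta> (tail H a) + ereal (c a)"
      using inv by (auto simp: st search_inv_def)
    \<comment> \<open>The exact unscanned node \<open>y\<close> is in the queue, so the choice of
      \<open>w\<close> gives \<open>D w \<le> D y = \<delta> y \<le> \<delta> w\<close>. In
      particular a node of \<open>T\<close> is tested at its true distance and cannot be
      pruned.\<close>
    have wT: "D w = \<delta> w" if "w \<in> T"
    proof -
      obtain y where y: "y \<in> T - S" "D y = \<delta> y" "\<delta> y \<le> \<delta> w"
        using unscanned_exact[of D S P] inv \<open>w \<in> T\<close> wF unfolding st by (metis DiffI empty_iff)
      then have "D w \<le> D y"
        using region_finite region_verts by (intro wmin) (auto simp: F_def)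
      with y I(1)[of w] show ?thesis by auto
    qed
    show ?thesis
    proof (cases "pr w (D w)")
      case True
      then have "w \<notin> T" using wT region_unpruned by force
      then have "search_inv (D, insert w S, P)"
        using I wF by (auto simp: search_inv_def)
      moreover have "scan_step H c pr st = (D, insert w S, P)"
        using True by (simp only: st scan if_True)
      ultimately show ?thesis by simp
    next
      case False
      define D' where "D' = (\<lambda>x. min (D x) (INF a\<in>{a \<in> arcs H. tail H a = w \<and> head H a = x}. D w + ereal (c a)))"
      have D'_le: "D' x \<le> D x" for x by (simp add: D'_def)
      have D'_arc: "D' (head H a) \<le> D w + ereal (c a)" if "a \<in> arcs H" "tail H a = w" for a
      proof -
        have "(INF a'\<in>{a' \<in> arcs H. tail H a' = w \<and> head H a' = head H a}. D w + ereal (c a')) \<le> D w + ereal (c a)"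
          by (rule INF_lower) (use that in auto)
        then show ?thesis by (simp add: D'_def min.coboundedI2)
      qed
      have D'_ge: "\<delta> x \<le> D' x" for x
        unfolding D'_def
      proof (intro min.boundedI INF_greatest I(1))
        fix a assume "a \<in> {a \<in> arcs H. tail H a = w \<and> head H a = x}"
        then show "\<delta> x \<le> D w + ereal (c a)"
          using delta_arc[of a] I(1)[of w] by (auto intro: order_trans add_right_mono)
      qed
      have "search_inv (D', insert w S, insert (w, D w) P)"
      proof -
        have 1: "D' u \<le> 0" using D'_le I(2) order_trans by blast
        have 2: "inj_on fst (insert (w, D w) P)"
          using I(4,5) wF(2) by (auto simp: inj_on_def)
        have 3: "x \<in> insert w S \<and> \<delta> x \<le> d \<and> d < \<infinity> \<and> \<not> pr x d"
          if "(x, d) \<in> insert (w, D w) P" for x d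
          using that I(1,5) wF(3) False by blast
        have 4: "(x, \<delta> x) \<in> insert (w, D w) P" if "x \<in> T" "x \<in> insert w S" for x
          using that wT I(6) by auto
        have 5: "D' (head H a) \<le> \<delta> (tail H a) + ereal (c a)"
          if "a \<in> arcs H" "tail H a \<in> T" "tail H a \<in> insert w S" for a
        proof (cases "tail H a = w")
          case True
          then show ?thesis using D'_arc wT that by auto
        next
          case False
          then have "D (head H a) \<le> \<delta> (tail H a) + ereal (c a)" using I(7) that by auto
          then show ?thesis using D'_le order_trans by blast
        qed
        have 6: "insert w S \<subseteq> verts H" using wF I(3) by simp
        show ?thesis
          unfolding search_inv_def case_prod_conv
          using D'_ge 1 2 3 4 5 6 by blast
      qed
      moreover have "scan_step H c pr st = (D', insert w S, insert (w, D w) P)"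
        using False by (simp only: st scan D'_def if_False)
      ultimately show ?thesis by simp
    qed
  qed
qed

lemma scan_step_progress:
  assumes "search_inv st" "scan_step H c pr st = (D', S', P')"
  shows "{w \<in> verts H. w \<notin> S' \<and> D' w < \<infinity>} = {} \<or> card S' = Suc (card (fst (snd st)))"
proof -
  obtain D S P where st: "st = (D, S, P)" by (cases st)
  define F where "F = {w \<in> verts H. w \<notin> S \<and> D w < \<infinity>}"
  show ?thesis
  proof (cases "F = {}")
    case True
    then have "(D', S', P') = (D, S, P)" using assms(2) scan_step_idle by (simp add: st F_def)
    with True show ?thesis by (simp add: F_def)
  next
    case False
    have finF: "finite F" using finite_verts by (auto simp: F_def)
    define w where "w = arg_min_on D F"
    have "w \<notin> S" using arg_min_if_finite(1)[OF finF False] by (auto simp: F_def w_def)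
    moreover have "S' = insert w S"
      using assms(2) scan_step_scan[OF False[unfolded F_def] w_def[unfolded F_def], of P]
      by (simp add: st split: if_splits)
    moreover have "finite S" using assms(1) finite_verts finite_subset by (auto simp: st search_inv_def)
    ultimately show ?thesis by (simp add: st)
  qed
qed

lemma scan_steps_inv: "search_inv ((scan_step H c pr ^^ n) ((\<lambda>x. if x = u then 0 else \<infinity>), {}, {}))"
  by (induction n) (simp_all add: search_inv_init search_inv_step)

text \<open>Each step scans a new node or leaves an empty queue as it is. For
  \<open>n = card (verts H)\<close> the second alternative means that all vertices are scanned, so
  the queue is empty in either case.\<close>

lemma scan_steps_exhaust:
  assumes "(scan_step H c pr ^^ n) ((\<lambda>x. if x = u then 0 else \<infinity>), {}, {}) = (D, S, P)"
  shows "{w \<in> verts H. w \<notin> S \<and> D w < \<infinity>} = {} \<or> card S = n"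
  using assms
proof (induction n arbitrary: D S P)
  case (Suc n)
  obtain D' S' P' where st: "(scan_step H c pr ^^ n) ((\<lambda>x. if x = u then 0 else \<infinity>), {}, {}) = (D', S', P')"
    by (metis prod_cases3)
  have step: "scan_step H c pr (D', S', P') = (D, S, P)" using Suc.prems st by simp
  from Suc.IH[OF st] show ?case
  proof
    assume "card S' = n"
    then show ?thesis using scan_step_progress[OF _ step] scan_steps_inv[of n] st by auto
  next
    assume "{w \<in> verts H. w \<notin> S' \<and> D' w < \<infinity>} = {}"
    moreover from this have "(D, S, P) = (D', S', P')"
      using step scan_step_idle by simp
    ultimately show ?thesis by simp
  qed
qed auto

lemma pruned_search_correct:
  shows pruned_search_sound: "(w, d) \<in> pruned_search H c pr u \<Longrightarrow> \<delta> w \<le> d \<and> d < \<infinity> \<and> \<not> pr w d"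
    and pruned_search_functional: "inj_on fst (pruned_search H c pr u)"
    and pruned_search_complete: "x \<in> T \<Longrightarrow> (x, \<delta> x) \<in> pruned_search H c pr u"
proof -
  obtain D S P where st:
      "(scan_step H c pr ^^ card (verts H)) ((\<lambda>x. if x = u then 0 else \<infinity>), {}, {}) = (D, S, P)"
    by (metis prod_cases3)
  then have P: "pruned_search H c pr u = P" by (simp add: pruned_search_def)
  have inv: "search_inv (D, S, P)" using scan_steps_inv[of "card (verts H)"] st by simp
  show "(w, d) \<in> pruned_search H c pr u \<Longrightarrow> \<delta> w \<le> d \<and> d < \<infinity> \<and> \<not> pr w d"
    "inj_on fst (pruned_search H c pr u)"
    using inv by (auto simp: P search_inv_def)
  have exhausted: "{w \<in> verts H. w \<notin> S \<and> D w < \<infinity>} = {}"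
    using scan_steps_exhaust[OF st]
  proof
    assume "card S = card (verts H)"
    then have "S = verts H" using inv finite_verts by (intro card_subset_eq) (auto simp: search_inv_def)
    then show ?thesis by simp
  qed
  \<comment> \<open>Otherwise an unscanned node of \<open>T\<close> would have a finite tentative
    distance and still be queued.\<close>
  have "T \<subseteq> S"
  proof (rule ccontr)
    assume "\<not> T \<subseteq> S"
    then obtain y where "y \<in> T - S" "D y = \<delta> y" using unscanned_exact[OF inv] by (metis Diff_eq_empty_iff)
    then show False using exhausted region_finite region_verts by force
  qed
  then show "x \<in> T \<Longrightarrow> (x, \<delta> x) \<in> pruned_search H c pr u"
    using inv by (auto simp: P search_inv_def)
qed

end

section \<open>Thresholds and the prune condition\<close>

text \<open>A downward closed predicate holds exactly on an initial segment of a sorted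
  list.\<close>

lemma less_length_filter_sorted_iff:
  fixes xs :: "'x::linorder list"
  assumes "sorted xs" "\<And>x y. x \<le> y \<Longrightarrow> P y \<Longrightarrow> P x"
  shows "k < length (filter P xs) \<longleftrightarrow> k < length xs \<and> P (xs ! k)"
  using assms(1)
proof (induction xs arbitrary: k)
  case (Cons x xs)
  show ?case
  proof (cases "P x")
    case True
    then show ?thesis using Cons by (cases k) auto
  next
    case False
    then have none: "\<not> P y" if "y \<in> set (x # xs)" for y
      using Cons.prems assms(2) that by auto
    then have "filter P (x # xs) = []" by (auto simp: filter_empty_conv)
    moreover have "\<not> P ((x # xs) ! k)" if "k < length (x # xs)"
      using none nth_mem[OF that] by blast
    ultimately show ?thesis by auto
  qed
qed simp

text \<open>Turns order statistics into counts; used with \<open>P\<close> of the form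
  \<open>x < d\<close> or \<open>x \<le> d\<close>. The conjunct \<open>k \<le> size M\<close>
  excludes the default value.\<close>

lemma kth_smallest_iff:
  assumes "1 \<le> k" "\<And>x y. x \<le> y \<Longrightarrow> P y \<Longrightarrow> P x"
  shows "k \<le> size (filter_mset P M) \<longleftrightarrow> k \<le> size M \<and> P (kth_smallest k dflt M)"
proof -
  let ?xs = "sorted_list_of_multiset M"
  have len: "length ?xs = size M" by (metis mset_sorted_list_of_multiset size_mset)
  have "size (filter_mset P M) = length (filter P ?xs)"
    by (metis mset_filter mset_sorted_list_of_multiset size_mset)
  then show ?thesis
    using less_length_filter_sorted_iff[of ?xs P "k - 1"] assms len
    by (auto simp: kth_smallest_def)
qed

lemma size_filter_entry_dists:
  "finite A \<Longrightarrow> size (filter_mset P (entry_dists A)) = card {e \<in> A. P (snd e)}"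
  by (simp add: entry_dists_def filter_mset_image_mset filter_mset_mset_set)

lemma prune_if_card:
  assumes "finite A" "1 \<le> k" "k \<le> card {e \<in> A. snd e < d}"
  shows "prune k A d"
  using kth_smallest_iff[of k "\<lambda>x. x < d" "entry_dists A" \<infinity>] assms
  by (auto simp: size_filter_entry_dists prune_def threshold_def)

text \<open>The disjuncts are the two ways to be pruned: \<open>d\<close> lies beyond the threshold,
  or it equals the threshold and the bit says that the next distance equals it too.\<close>

lemma prune_imp_card:
  assumes "finite A" "1 \<le> k" "prune k A d"
  shows "k \<le> card {e \<in> A. snd e < d} \<or> Suc k \<le> card {e \<in> A. snd e \<le> d}"
proof (cases "threshold k A < d")
  case True
  \<comment> \<open>With fewer than \<open>k\<close> entries the threshold is
    \<open>\<infinity>\<close>, which is not below \<open>d\<close>.\<close>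
  then have "k \<le> size (entry_dists A)" by (auto simp: threshold_def kth_smallest_def split: if_splits)
  then show ?thesis
    using True kth_smallest_iff[of k "\<lambda>x. x < d" "entry_dists A" \<infinity>] assms
    by (auto simp: size_filter_entry_dists threshold_def)
next
  case False
  then have "d = threshold k A" "star_bit k A" using assms(3) by (auto simp: prune_def)
  then show ?thesis
    using kth_smallest_iff[of "Suc k" "\<lambda>x. x \<le> d" "entry_dists A" \<infinity>] assms(1)
    by (auto simp: size_filter_entry_dists threshold_def star_bit_def)
qed

section \<open>Sketches of prefixes\<close>

text \<open>With \<open>Y\<close> the rankees before the batch this decides whether \<open>u\<close>
  is proposed, with \<open>Y\<close> all predecessors whether it is inserted. The strict inequality
  makes membership of \<open>u\<close> in \<open>Y\<close> irrelevant.\<close>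

definition admitted :: "('a \<Rightarrow> ereal) \<Rightarrow> nat \<Rightarrow> 'a set \<Rightarrow> 'a \<Rightarrow> bool" where
  "admitted \<delta> k Y u \<longleftrightarrow> \<delta> u < \<infinity> \<and> card {h \<in> Y. \<delta> h < \<delta> u} < k"

text \<open>The result of testing each rankee against all its predecessors. It does not depend on
  the batches, so it can serve as the invariant at every batch end.\<close>

definition prefix_sketch :: "('a \<Rightarrow> ereal) \<Rightarrow> nat \<Rightarrow> 'a list \<Rightarrow> 'a sketch" where
  "prefix_sketch \<delta> k xs =
     (\<lambda>i. (xs ! i, \<delta> (xs ! i))) ` {i. i < length xs \<and> admitted \<delta> k (set (take i xs)) (xs ! i)}"

lemma admitted_antimono:
  assumes "finite Z" "Y \<subseteq> Z" "admitted \<delta> k Z u"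
  shows "admitted \<delta> k Y u"
proof -
  have "card {h \<in> Y. \<delta> h < \<delta> u} \<le> card {h \<in> Z. \<delta> h < \<delta> u}"
    using assms by (intro card_mono) auto
  then show ?thesis using assms(3) by (simp add: admitted_def)
qed

lemma prefix_sketch_Nil [simp]: "prefix_sketch \<delta> k [] = {}"
  by (simp add: prefix_sketch_def)

lemma prefix_sketch_snoc:
  "prefix_sketch \<delta> k (ys @ [u]) =
    (if admitted \<delta> k (set ys) u then insert (u, \<delta> u) (prefix_sketch \<delta> k ys) else prefix_sketch \<delta> k ys)"
proof -
  have "{i. i < length (ys @ [u]) \<and> admitted \<delta> k (set (take i (ys @ [u]))) ((ys @ [u]) ! i)} =
    {i. i < length ys \<and> admitted \<delta> k (set (take i ys)) (ys ! i)} \<union>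
    (if admitted \<delta> k (set ys) u then {length ys} else {})"
    by (auto simp: less_Suc_eq nth_append)
  then show ?thesis
    unfolding prefix_sketch_def by (auto simp: nth_append image_iff)
qed

lemma finite_prefix_sketch [simp]: "finite (prefix_sketch \<delta> k ys)"
  by (simp add: prefix_sketch_def)

lemma prefix_sketch_memD: "e \<in> prefix_sketch \<delta> k ys \<Longrightarrow> fst e \<in> set ys \<and> snd e = \<delta> (fst e)"
  by (auto simp: prefix_sketch_def)

lemma card_prefix_sketch:
  assumes "distinct xs"
  shows "card (prefix_sketch \<delta> k xs) = card {i. i < length xs \<and> admitted \<delta> k (set (take i xs)) (xs ! i)}"
  unfolding prefix_sketch_def
  by (rule card_image) (use assms in \<open>auto simp: inj_on_def nth_eq_iff_index_eq\<close>)

lemma min_card_prefix_sketch: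
  assumes "distinct ys"
  shows "min k (card {e \<in> prefix_sketch \<delta> k ys. snd e < x}) = min k (card {h \<in> set ys. \<delta> h < x})"
  using assms
proof (induction ys rule: rev_induct)
  case (snoc u ys)
  let ?K = "prefix_sketch \<delta> k ys"
  have IH: "min k (card {e \<in> ?K. snd e < x}) = min k (card {h \<in> set ys. \<delta> h < x})"
    using snoc by simp
  have u: "u \<notin> set ys" "(u, \<delta> u) \<notin> ?K" using snoc.prems prefix_sketch_memD by force+
  show ?case
  proof (cases "\<delta> u < x")
    case False
    then have "{e \<in> prefix_sketch \<delta> k (ys @ [u]). snd e < x} = {e \<in> ?K. snd e < x}"
      "{h \<in> set (ys @ [u]). \<delta> h < x} = {h \<in> set ys. \<delta> h < x}"
      by (auto simp: prefix_sketch_snoc)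
    then show ?thesis using IH by simp
  next
    case True
    have "{h \<in> set (ys @ [u]). \<delta> h < x} = insert u {h \<in> set ys. \<delta> h < x}" using True by auto
    then have c: "card {h \<in> set (ys @ [u]). \<delta> h < x} = Suc (card {h \<in> set ys. \<delta> h < x})"
      using u by simp
    show ?thesis
    proof (cases "admitted \<delta> k (set ys) u")
      case adm: True
      then have "{e \<in> prefix_sketch \<delta> k (ys @ [u]). snd e < x} = insert (u, \<delta> u) {e \<in> ?K. snd e < x}"
        using True by (auto simp: prefix_sketch_snoc)
      then have "card {e \<in> prefix_sketch \<delta> k (ys @ [u]). snd e < x} = Suc (card {e \<in> ?K. snd e < x})"
        using u by simp
      then show ?thesis using c IH by (simp add: min_def split: if_splits)
    next
      case False
      have "k \<le> card {h \<in> set ys. \<delta> h < \<delta> u}"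
        using False True by (auto simp: admitted_def)
      also have "\<dots> \<le> card {h \<in> set ys. \<delta> h < x}"
        using True by (intro card_mono) auto
      finally show ?thesis using c IH False by (simp add: prefix_sketch_snoc min_def split: if_splits)
    qed
  qed
qed simp

text \<open>Distinct distances allow at most one entry at distance exactly \<open>x\<close>, so
  \<open>k + 1\<close> entries within \<open>x\<close> include \<open>k\<close> strictly closer
  ones. Both ways to be pruned thus reduce to one count, which \<open>min_card_prefix_sketch\<close>
  transfers to the whole prefix.\<close>

lemma prune_prefix_sketch_iff:
  assumes "distinct ys" "inj_on \<delta> {h \<in> set ys. \<delta> h < \<infinity>}" "1 \<le> k" "x < \<infinity>"
  shows "prune k (prefix_sketch \<delta> k ys) x \<longleftrightarrow> k \<le> card {h \<in> set ys. \<delta> h < x}"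
proof -
  let ?K = "prefix_sketch \<delta> k ys"
  have "k \<le> card {e \<in> ?K. snd e < x}" if pr: "prune k ?K x"
  proof (cases "k \<le> card {e \<in> ?K. snd e < x}")
    case False
    then have "Suc k \<le> card {e \<in> ?K. snd e \<le> x}"
      using prune_imp_card[OF _ assms(3) pr] by auto
    also have "{e \<in> ?K. snd e \<le> x} = {e \<in> ?K. snd e < x} \<union> {e \<in> ?K. snd e = x}" by auto
    also have "card \<dots> \<le> card {e \<in> ?K. snd e < x} + card {e \<in> ?K. snd e = x}" by (rule card_Un_le)
    also have "card {e \<in> ?K. snd e = x} \<le> 1"
      unfolding One_nat_def
    proof (rule card_le_Suc0_iff_eq[THEN iffD2])
      show "\<forall>a\<in>{e \<in> ?K. snd e = x}. \<forall>b\<in>{e \<in> ?K. snd e = x}. a = b"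
      proof (intro ballI)
        fix a b assume "a \<in> {e \<in> ?K. snd e = x}" "b \<in> {e \<in> ?K. snd e = x}"
        then have ab: "fst a \<in> set ys" "fst b \<in> set ys" "\<delta> (fst a) = x" "\<delta> (fst b) = x" "snd a = x" "snd b = x"
          using prefix_sketch_memD[of a \<delta> k ys] prefix_sketch_memD[of b \<delta> k ys] by auto
        then have "fst a = fst b" using inj_onD[OF assms(2)] assms(4) by auto
        with ab show "a = b" by (simp add: prod_eq_iff)
      qed
    qed simp
    finally show ?thesis by simp
  qed
  then have "prune k ?K x \<longleftrightarrow> k \<le> card {e \<in> ?K. snd e < x}"
    using prune_if_card[of ?K k x] assms(3) by auto
  also have "\<dots> \<longleftrightarrow> k \<le> card {h \<in> set ys. \<delta> h < x}"
    using min_card_prefix_sketch[OF assms(1), of k \<delta> x] by (auto simp: min_def split: if_splits)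
  finally show ?thesis .
qed

lemma process_batch:
  assumes xs: "distinct xs" and inj: "inj_on \<delta> {h \<in> set xs. \<delta> h < \<infinity>}" and "1 \<le> k"
    and se: "s \<le> e" "e \<le> length xs" and "finite X"
  shows "\<exists>X'. foldl (insert_entry k) (prefix_sketch \<delta> k (take s xs), X)
        (map (\<lambda>u. (u, \<delta> u)) (filter (admitted \<delta> k (set (take s xs))) (drop s (take e xs)))) =
      (prefix_sketch \<delta> k (take e xs), X') \<and> finite X' \<and>
      card X' \<le> card X + card {i \<in> {s..<e}. admitted \<delta> k (set (take s xs)) (xs ! i) \<and>
        \<not> admitted \<delta> k (set (take i xs)) (xs ! i)}"
  using se
proof (induction e rule: dec_induct)
  case base
  then show ?case using \<open>finite X\<close> by simp
next
  case (step e)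
  let ?adm = "\<lambda>s. admitted \<delta> k (set (take s xs)) (xs ! e)"
  let ?late = "\<lambda>e. {i \<in> {s..<e}. admitted \<delta> k (set (take s xs)) (xs ! i) \<and>
        \<not> admitted \<delta> k (set (take i xs)) (xs ! i)}"
  have e: "e < length xs" using step.prems by simp
  then have take: "take (Suc e) xs = take e xs @ [xs ! e]" by (rule take_Suc_conv_app_nth)
  with step.hyps e have drop: "drop s (take (Suc e) xs) = drop s (take e xs) @ [xs ! e]" by simp
  obtain X' where X': "foldl (insert_entry k) (prefix_sketch \<delta> k (take s xs), X)
        (map (\<lambda>u. (u, \<delta> u)) (filter (admitted \<delta> k (set (take s xs))) (drop s (take e xs)))) =
      (prefix_sketch \<delta> k (take e xs), X')" "finite X'" "card X' \<le> card X + card (?late e)"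
    using step.IH e by auto
  have mono: "?adm e \<Longrightarrow> ?adm s"
    using step.hyps by (rule_tac admitted_antimono) (auto intro: set_take_subset_set_take[THEN subsetD])
  have late_mono: "card (?late e) \<le> card (?late (Suc e))" by (intro card_mono) auto
  show ?case
  proof (cases "?adm s")
    case False
    then have "filter (admitted \<delta> k (set (take s xs))) (drop s (take (Suc e) xs)) =
        filter (admitted \<delta> k (set (take s xs))) (drop s (take e xs))"
      unfolding drop by simp
    moreover have "prefix_sketch \<delta> k (take (Suc e) xs) = prefix_sketch \<delta> k (take e xs)"
      unfolding take prefix_sketch_snoc using False mono by auto
    ultimately show ?thesis using X' late_mono by auto
  next
    case True
    have inj': "inj_on \<delta> {h \<in> set (take e xs). \<delta> h < \<infinity>}"
      by (rule inj_on_subset[OF inj]) (auto dest: in_set_takeD)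
    have "prune k (prefix_sketch \<delta> k (take e xs)) (\<delta> (xs ! e)) \<longleftrightarrow> \<not> ?adm e"
      using True prune_prefix_sketch_iff[OF _ inj' \<open>1 \<le> k\<close>, of "\<delta> (xs ! e)"] xs
      by (auto simp: admitted_def)
    then have res: "foldl (insert_entry k) (prefix_sketch \<delta> k (take s xs), X)
        (map (\<lambda>u. (u, \<delta> u)) (filter (admitted \<delta> k (set (take s xs))) (drop s (take (Suc e) xs)))) =
      (prefix_sketch \<delta> k (take (Suc e) xs), if ?adm e then X' else insert (xs ! e, \<delta> (xs ! e)) X')"
      unfolding drop unfolding take prefix_sketch_snoc using X'(1) True by (simp add: insert_entry_def)
    have "card (?late (Suc e)) = Suc (card (?late e))" if "\<not> ?adm e"
    proof -
      have "?late (Suc e) = insert e (?late e)"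
        using that True step.hyps by (auto simp: less_Suc_eq)
      then show ?thesis by simp
    qed
    moreover have "card (insert (xs ! e, \<delta> (xs ! e)) X') \<le> Suc (card X')"
      using X'(2) by (simp add: card_insert_if)
    ultimately show ?thesis
      using res X'(2,3) late_mono by (cases "?adm e") auto
  qed
qed

lemma card_admitted:
  assumes "finite Y" "inj_on \<delta> {u \<in> Y. \<delta> u < \<infinity>}"
  shows "card {u \<in> Y. admitted \<delta> k Y u} = min k (card {u \<in> Y. \<delta> u < \<infinity>})"
proof -
  have main: "card {u \<in> S. card {h \<in> S. \<delta> h < \<delta> u} < k} = min k (card S)"
    if "finite S" "inj_on \<delta> S" for S
    using that
  proof (induction rule: finite_ranking_induct[where f = \<delta>])
    case (insert x S)
    show ?case
    proof (cases "x \<in> S")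
      case True
      then show ?thesis using insert by (simp add: insert_absorb)
    next
      case False
      have less: "\<delta> y < \<delta> x" if "y \<in> S" for y
        using insert.hyps(2)[OF that] insert.prems False that by (auto simp: less_le image_iff)
      have x: "{h \<in> insert x S. \<delta> h < \<delta> x} = S" using less by auto
      have y: "{h \<in> insert x S. \<delta> h < \<delta> y} = {h \<in> S. \<delta> h < \<delta> y}" if "y \<in> S" for y
        using less[OF that] by auto
      have "{u \<in> insert x S. card {h \<in> insert x S. \<delta> h < \<delta> u} < k} =
        {u \<in> S. card {h \<in> S. \<delta> h < \<delta> u} < k} \<union> (if card S < k then {x} else {})"
        using x y by auto
      moreover have "card {u \<in> S. card {h \<in> S. \<delta> h < \<delta> u} < k} = min k (card S)"
        using insert by simp
      ultimately show ?thesis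
        using insert.hyps(1) False by (auto simp: card_insert_if)
    qed
  qed simp
  define S where "S = {u \<in> Y. \<delta> u < \<infinity>}"
  have "{h \<in> Y. \<delta> h < \<delta> u} = {h \<in> S. \<delta> h < \<delta> u}" if "\<delta> u < \<infinity>" for u
    using that by (auto simp: S_def)
  then have "{u \<in> Y. admitted \<delta> k Y u} = {u \<in> S. card {h \<in> S. \<delta> h < \<delta> u} < k}"
    by (auto simp: admitted_def S_def)
  then show ?thesis using main[of S] assms by (simp add: S_def)
qed

lemma rank_val_nth:
  assumes "distinct xs" "i < length xs"
  shows "rank_val xs (xs ! i) = real (Suc i) / real (length xs)"
proof -
  have "takeWhile (\<lambda>w. w \<noteq> xs ! i) xs = take i xs"
    using assms by (intro takeWhile_eq_take_P_nth) (auto simp: nth_eq_iff_index_eq)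
  then show ?thesis using assms by (simp add: rank_val_def)
qed

text \<open>The rank condition says that fewer than \<open>k\<close> rankees within distance
  \<open>d_vu\<close> have smaller rank. Smaller rank means earlier in \<open>xs\<close>, and by
  distinctness such a rankee, being different from \<open>u\<close>, is strictly closer.\<close>

lemma ADS_eq_prefix_sketch:
  assumes perm: "xs \<in> permutations_of_set U" and "1 \<le> k" and "distinct_dists G c U v"
  shows "ADS G c U k (rank_val xs) v = prefix_sketch (sp_dist G c v) k xs"
proof -
  let ?d = "sp_dist G c v" and ?r = "rank_val xs"
  have xs: "set xs = U" "distinct xs" using perm by (auto dest: permutations_of_setD)
  then have finU: "finite U" by auto
  have mem: "u \<in> U \<longleftrightarrow> (\<exists>i<length xs. u = xs ! i)" for u
    using xs(1) by (auto simp: in_set_conv_nth)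
  have rank_less: "?r (xs ! j) < ?r (xs ! i) \<longleftrightarrow> j < i" if "i < length xs" "j < length xs" for i j
    using that xs(2) by (auto simp: rank_val_nth divide_less_cancel)
  have inj: "h = u" if "h \<in> U" "u \<in> U" "?d h = ?d u" "?d u < \<infinity>" for h u
    using inj_onD[OF assms(3)[unfolded distinct_dists_def], of h u] that by simp
  have key: "?r (xs ! i) \<le> kth_smallest k (SUP u\<in>U. ?r u) (image_mset ?r (mset_set {h \<in> U. ?d h \<le> ?d (xs ! i)}))
      \<longleftrightarrow> card {h \<in> set (take i xs). ?d h < ?d (xs ! i)} < k"
    if i: "i < length xs" and fin: "?d (xs ! i) < \<infinity>" for i
  proof -
    define u where "u = xs ! i"
    define H where "H = {h \<in> U. ?d h \<le> ?d u}"
    define M where "M = image_mset ?r (mset_set H)"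
    have u: "u \<in> U" using i mem by (auto simp: u_def)
    have finH: "finite H" using finU by (simp add: H_def)
    have "{h \<in> H. ?r h < ?r u} = {h \<in> set (take i xs). ?d h < ?d u}"
    proof (intro set_eqI iffI)
      fix h assume h: "h \<in> {h \<in> H. ?r h < ?r u}"
      then obtain j where j: "j < length xs" "h = xs ! j" using mem by (auto simp: H_def)
      then have "j < i" using h rank_less i by (auto simp: u_def)
      then have "h \<in> set (take i xs)" using j i by (auto simp: in_set_conv_nth)
      moreover have "?d h \<noteq> ?d u" using inj[of h u] u h fin by (auto simp: H_def u_def)
      ultimately show "h \<in> {h \<in> set (take i xs). ?d h < ?d u}" using h by (auto simp: H_def)
    next
      fix h assume h: "h \<in> {h \<in> set (take i xs). ?d h < ?d u}"
      then obtain j where j: "j < i" "h = xs ! j" by (auto simp: in_set_conv_nth)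
      then have "?r h < ?r u" "h \<in> U" using rank_less i xs(1) by (auto simp: u_def)
      then show "h \<in> {h \<in> H. ?r h < ?r u}" using h by (auto simp: H_def)
    qed
    then have size_less: "size (filter_mset (\<lambda>x. x < ?r u) M) = card {h \<in> set (take i xs). ?d h < ?d u}"
      using finH by (simp add: M_def filter_mset_image_mset filter_mset_mset_set)
    have iff: "k \<le> size (filter_mset (\<lambda>x. x < ?r u) M) \<longleftrightarrow>
        k \<le> size M \<and> kth_smallest k (SUP u\<in>U. ?r u) M < ?r u"
      using assms(2) by (intro kth_smallest_iff) auto
    have "?r u \<le> kth_smallest k (SUP u\<in>U. ?r u) M \<longleftrightarrow> \<not> k \<le> size (filter_mset (\<lambda>x. x < ?r u) M)"
    proof (cases "k \<le> size M")
      case True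
      then show ?thesis using iff by auto
    next
      case False
      \<comment> \<open>The default is an upper bound of all ranks, so the rank condition holds; and
        fewer than \<open>k\<close> elements cannot contain \<open>k\<close> smaller ones.\<close>
      then have "kth_smallest k (SUP u\<in>U. ?r u) M = (SUP u\<in>U. ?r u)"
        by (simp add: kth_smallest_def)
      then have "?r u \<le> kth_smallest k (SUP u\<in>U. ?r u) M"
        using u finU by (auto intro!: cSUP_upper)
      then show ?thesis using iff False by auto
    qed
    then show ?thesis using size_less by (simp add: M_def H_def u_def not_le)
  qed
  show ?thesis
  proof (intro set_eqI iffI)
    fix e assume "e \<in> ADS G c U k ?r v"
    then obtain i where "i < length xs" "e = (xs ! i, ?d (xs ! i))" "admitted ?d k (set (take i xs)) (xs ! i)"
      using mem key by (auto simp: ADS_def admitted_def)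
    then show "e \<in> prefix_sketch ?d k xs" by (auto simp: prefix_sketch_def)
  next
    fix e assume "e \<in> prefix_sketch ?d k xs"
    then obtain i where i: "i < length xs" "e = (xs ! i, ?d (xs ! i))" "admitted ?d k (set (take i xs)) (xs ! i)"
      by (auto simp: prefix_sketch_def)
    then show "e \<in> ADS G c U k ?r v"
      using key[OF i(1)] mem by (auto simp: ADS_def admitted_def)
  qed
qed

section \<open>Correctness of the batched algorithm\<close>

text \<open>Distances are assumed distinct only from \<open>v\<close>. At the other nodes, sketches
  may differ from the true ones and contain overestimates; this weak property is what the prune
  tests there can rely on.\<close>

definition sound_entries :: "('a, 'b) pre_digraph \<Rightarrow> ('b \<Rightarrow> real) \<Rightarrow> 'a \<Rightarrow> 'a set \<Rightarrow> 'a sketch \<Rightarrow> bool" where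
  "sound_entries G c w Y A \<longleftrightarrow> finite A \<and> inj_on fst A \<and> (\<forall>(h, d)\<in>A. h \<in> Y \<and> sp_dist G c w h \<le> d)"

lemma foldl_insert_entry_subset: "fst (foldl (insert_entry k) S es) \<subseteq> fst S \<union> set es"
proof (induction es arbitrary: S)
  case (Cons e es)
  have "fst (insert_entry k S e) \<subseteq> insert e (fst S)"
    by (cases S) (auto simp: insert_entry_def)
  with Cons.IH[of "insert_entry k S e"] show ?case by auto
qed simp

lemma the_snd_eq: "inj_on fst P \<Longrightarrow> (w, d) \<in> P \<Longrightarrow> (THE d. (w, d) \<in> P) = d"
  by (rule the_equality) (metis fst_conv inj_onD prod.inject)+

context
  fixes G :: "('a, 'b) pre_digraph" and c :: "'b \<Rightarrow> real"
  assumes fin_G: "fin_digraph G" and pos: "\<And>a. a \<in> arcs G \<Longrightarrow> 0 < c a"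
begin

interpretation G: fin_digraph G by (rule fin_G)

lemma arcs_nonneg: "a \<in> arcs G \<Longrightarrow> 0 \<le> c a"
  using pos by (simp add: less_imp_le)

lemma unpruned_region_transpose:
  assumes "u \<in> verts G" "T \<subseteq> verts G"
    and "\<And>x. x \<in> T \<Longrightarrow> sp_dist G c x u < \<infinity> \<and> \<not> pr x (sp_dist G c x u)"
    and "\<And>x. x \<in> T \<Longrightarrow> x \<noteq> u \<Longrightarrow>
      \<exists>a\<in>arcs G. tail G a = x \<and> head G a \<in> T \<and> sp_dist G c x u = sp_dist G c (head G a) u + ereal (c a)"
  shows "unpruned_region (transpose_graph G) c pr u (\<lambda>w. sp_dist G c w u) T"
proof unfold_locales
  show "sp_dist G c u u = 0" using G.mu_self[of c u] arcs_nonneg assms(1) by simp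
  show "0 \<le> sp_dist G c x u" for x using G.mu_nonneg[of c x u] arcs_nonneg by simp
  fix a assume "a \<in> arcs (transpose_graph G)"
  then have a: "a \<in> arcs G" by (simp add: transpose_graph_def)
  show "sp_dist G c (head (transpose_graph G) a) u \<le> sp_dist G c (tail (transpose_graph G) a) u + ereal (c a)"
    using G.mu_arc[of c a u] arcs_nonneg a by (simp add: transpose_graph_def add.commute)
qed (use assms pos in \<open>auto simp: transpose_graph_def\<close>)

lemma search_sound:
  assumes "u \<in> verts G"
  shows "(w, d) \<in> pruned_search (transpose_graph G) c pr u \<Longrightarrow> sp_dist G c w u \<le> d \<and> d < \<infinity> \<and> \<not> pr w d"
    and "inj_on fst (pruned_search (transpose_graph G) c pr u)"
proof -
  \<comment> \<open>Soundness and functionality do not mention the region, so the empty one is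
    chosen.\<close>
  interpret unpruned_region "transpose_graph G" c pr u "\<lambda>w. sp_dist G c w u" "{}"
    using assms by (intro unpruned_region_transpose) auto
  show "(w, d) \<in> pruned_search (transpose_graph G) c pr u \<Longrightarrow> sp_dist G c w u \<le> d \<and> d < \<infinity> \<and> \<not> pr w d"
    "inj_on fst (pruned_search (transpose_graph G) c pr u)"
    by (rule pruned_search_sound pruned_search_functional, assumption?)+
qed

text \<open>The region \<open>T\<close> consists of the nodes on shortest paths from
  \<open>v\<close> to \<open>u\<close>. By the triangle inequality, the first arc of a shortest walk
  from such a node to \<open>u\<close> stays inside \<open>T\<close>.\<close>

lemma search_complete:
  assumes "u \<in> verts G" "v \<in> verts G" "sp_dist G c v u < \<infinity>"
    and unpruned: "\<And>w. sp_dist G c v w + sp_dist G c w u = sp_dist G c v u \<Longrightarrow> \<not> pr w (sp_dist G c w u)"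
  shows "(v, sp_dist G c v u) \<in> pruned_search (transpose_graph G) c pr u"
proof -
  let ?d = "sp_dist G c"
  have nonneg: "0 \<le> ?d x y" for x y using G.mu_nonneg[of c x y] arcs_nonneg by simp
  have tri: "?d x z \<le> ?d x y + ?d y z" for x y z using G.mu_triangle[of c x z y] arcs_nonneg by simp
  define T where "T = {w \<in> verts G. ?d v w + ?d w u = ?d v u}"
  have fin: "?d w u < \<infinity>" "?d v w < \<infinity>" if "w \<in> T" for w
    using that assms(3) by (auto simp: T_def)
  interpret unpruned_region "transpose_graph G" c pr u "\<lambda>w. ?d w u" T
  proof (rule unpruned_region_transpose)
    fix x assume x: "x \<in> T" "x \<noteq> u"
    obtain a where a: "a \<in> arcs G" "tail G a = x" "?d x u = ereal (c a) + ?d (head G a) u"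
      by (rule G.mu_first_arc[of c x u]) (use arcs_nonneg fin x in auto)
    have "?d v (head G a) \<le> ?d v x + ereal (c a)"
    proof -
      have "?d x (head G a) \<le> ereal (c a)"
        using G.mu_arc[of c a "head G a"] arcs_nonneg a G.mu_self[of c "head G a"] by simp
      then show ?thesis using tri[of v "head G a" x] add_left_mono order_trans by blast
    qed
    then have "?d v (head G a) + ?d (head G a) u \<le> ?d v x + ereal (c a) + ?d (head G a) u"
      by (intro add_right_mono)
    also have "\<dots> = ?d v u" using x(1) a(3) by (simp add: T_def add.assoc)
    finally have "head G a \<in> T" using tri[of v u "head G a"] a(1) by (auto simp: T_def intro: antisym)
    then show "\<exists>a\<in>arcs G. tail G a = x \<and> head G a \<in> T \<and> ?d x u = ?d (head G a) u + ereal (c a)"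
      using a by (auto simp: add.commute)
  qed (use assms fin in \<open>auto simp: T_def\<close>)
  have "v \<in> T" using assms G.mu_self[of c v] arcs_nonneg by (simp add: T_def)
  then show ?thesis by (rule pruned_search_complete)
qed

lemma proposed_sound:
  assumes "set b \<subseteq> verts G"
  shows "inj_on fst (set (proposed G c k st b w))"
    and "(u, d) \<in> set (proposed G c k st b w) \<Longrightarrow> u \<in> set b \<and> sp_dist G c w u \<le> d"
proof -
  show "inj_on fst (set (proposed G c k st b w))"
    by (auto simp: proposed_def inj_on_def split: if_splits)
  assume ud: "(u, d) \<in> set (proposed G c k st b w)"
  let ?P = "pruned_search (transpose_graph G) c (\<lambda>w. prune k (fst (st w))) u"
  have u: "u \<in> set b" "w \<in> fst ` ?P" "d = (THE d. (w, d) \<in> ?P)"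
    using ud by (auto simp: proposed_def split: if_splits)
  then obtain d' where d': "(w, d') \<in> ?P" by auto
  have "inj_on fst ?P" using search_sound(2) assms u by blast
  then have "d = d'" using u(3) d' by (simp add: the_snd_eq)
  then show "u \<in> set b \<and> sp_dist G c w u \<le> d"
    using search_sound(1)[OF _ d'] u assms by auto
qed

lemma run_batch_sound:
  assumes "sound_entries G c w Y (fst (st w))" "set b \<subseteq> verts G" "Y \<inter> set b = {}"
  shows "sound_entries G c w (Y \<union> set b) (fst (run_batch G c k st b w))"
proof -
  let ?p = "set (proposed G c k st b w)"
  have sub: "fst (run_batch G c k st b w) \<subseteq> fst (st w) \<union> ?p"
    unfolding run_batch_def by (rule foldl_insert_entry_subset)
  have p: "inj_on fst ?p" "\<And>u d. (u, d) \<in> ?p \<Longrightarrow> u \<in> set b \<and> sp_dist G c w u \<le> d"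
    using proposed_sound[OF assms(2)] by blast+
  have "fst ` fst (st w) \<subseteq> Y" using assms(1) by (auto simp: sound_entries_def)
  moreover have "fst ` ?p \<subseteq> set b" using p(2) by auto
  ultimately have "inj_on fst (fst (st w) \<union> ?p)"
    using assms(1,3) p(1) by (subst inj_on_Un) (auto simp: sound_entries_def)
  then show ?thesis
    using sub assms(1) p(2) unfolding sound_entries_def
    by (auto intro: inj_on_subset finite_subset)
qed

text \<open>If the search for \<open>u\<close> is pruned at a node \<open>w\<close> on a shortest path to \<open>v\<close>, then the entries of
  \<open>w\<close> responsible for this are at least as close to \<open>v\<close> as \<open>u\<close> is. The distinctness of the
  distances from \<open>v\<close> makes up for possible ties at \<open>w\<close>.\<close>

lemma unpruned_if_admitted:
  assumes sound: "sound_entries G c w Y A" and "finite Y" "1 \<le> k" "u \<notin> Y"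
    and inj: "inj_on (sp_dist G c v) {h \<in> insert u Y. sp_dist G c v h < \<infinity>}"
    and adm: "admitted (sp_dist G c v) k Y u"
    and w: "sp_dist G c v w + sp_dist G c w u = sp_dist G c v u"
  shows "\<not> prune k A (sp_dist G c w u)"
proof
  let ?d = "sp_dist G c" and ?closer = "{h \<in> Y. sp_dist G c v h < sp_dist G c v u}"
  assume "prune k A (?d w u)"
  moreover have A: "finite A" "inj_on fst A" "\<And>h d. (h, d) \<in> A \<Longrightarrow> h \<in> Y \<and> ?d w h \<le> d"
    using sound by (auto simp: sound_entries_def)
  ultimately have many: "k \<le> card {e \<in> A. snd e < ?d w u} \<or> Suc k \<le> card {e \<in> A. snd e \<le> ?d w u}"
    using prune_imp_card \<open>1 \<le> k\<close> by blast
  have fin: "?d v u < \<infinity>" and few: "card ?closer < k" using adm by (auto simp: admitted_def)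
  have le: "?d v h \<le> ?d v u" if "(h, d) \<in> A" "d \<le> ?d w u" for h d
  proof -
    have "?d v h \<le> ?d v w + ?d w h" using G.mu_triangle[of c v h w] arcs_nonneg by simp
    also have "?d w h \<le> ?d w u" using A(3)[OF that(1)] that(2) order_trans by blast
    then have "?d v w + ?d w h \<le> ?d v w + ?d w u" by (rule add_left_mono)
    finally show ?thesis using w by simp
  qed
  have less: "h \<in> ?closer" if "(h, d) \<in> A" "d \<le> ?d w u" for h d
  proof -
    have "h \<in> Y" using A(3)[OF that(1)] by simp
    moreover have "?d v h \<noteq> ?d v u"
      using inj_onD[OF inj, of h u] \<open>h \<in> Y\<close> fin \<open>u \<notin> Y\<close> by auto
    ultimately show ?thesis using le[OF that] by simp
  qed
  have "card {e \<in> A. snd e \<le> ?d w u} = card (fst ` {e \<in> A. snd e \<le> ?d w u})"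
    using A(2) by (intro card_image[symmetric]) (auto intro: inj_on_subset)
  also have "\<dots> \<le> card ?closer"
    using less \<open>finite Y\<close> by (intro card_mono) auto
  finally have "card {e \<in> A. snd e \<le> ?d w u} < k" using few by simp
  moreover have "card {e \<in> A. snd e < ?d w u} \<le> card {e \<in> A. snd e \<le> ?d w u}"
    using A(1) by (intro card_mono) auto
  ultimately show False using many by simp
qed

lemma proposed_exact:
  assumes sound: "\<And>w. sound_entries G c w (set ys) (fst (st w))"
    and sketch: "fst (st v) = prefix_sketch (sp_dist G c v) k ys"
    and "distinct ys" "set ys \<inter> set b = {}" "set b \<subseteq> verts G" "v \<in> verts G" "1 \<le> k"
    and inj: "inj_on (sp_dist G c v) {h \<in> set ys \<union> set b. sp_dist G c v h < \<infinity>}"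
  shows "proposed G c k st b v =
    map (\<lambda>u. (u, sp_dist G c v u)) (filter (admitted (sp_dist G c v) k (set ys)) b)"
proof -
  let ?d = "sp_dist G c v" and ?pr = "\<lambda>w. prune k (fst (st w))"
  let ?P = "\<lambda>u. pruned_search (transpose_graph G) c ?pr u"
  have found: "(v, ?d u) \<in> ?P u" if u: "u \<in> set b" "admitted ?d k (set ys) u" for u
  proof (rule search_complete)
    fix w assume "?d w + sp_dist G c w u = ?d u"
    moreover have "inj_on ?d {h \<in> insert u (set ys). ?d h < \<infinity>}"
      using u by (intro inj_on_subset[OF inj]) auto
    ultimately show "\<not> ?pr w (sp_dist G c w u)"
      using unpruned_if_admitted[OF sound] assms u by blast
  qed (use assms u in \<open>auto simp: admitted_def\<close>)
  have adm: "admitted ?d k (set ys) u" if u: "u \<in> set b" and d: "(v, d) \<in> ?P u" for u d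
  proof -
    have le: "?d u \<le> d" "d < \<infinity>" "\<not> ?pr v d"
      using search_sound(1)[OF _ d] u assms(5) by auto
    have "inj_on ?d {h \<in> set ys. ?d h < \<infinity>}" by (rule inj_on_subset[OF inj]) auto
    then have "card {h \<in> set ys. ?d h < d} < k"
      using le(2,3) prune_prefix_sketch_iff[of ys ?d k d] assms(3,7) by (simp add: sketch not_le)
    moreover have "card {h \<in> set ys. ?d h < ?d u} \<le> card {h \<in> set ys. ?d h < d}"
      using le(1) by (intro card_mono) auto
    moreover have "?d u < \<infinity>" using le by (auto intro: le_less_trans)
    ultimately show ?thesis by (simp add: admitted_def)
  qed
  have the: "(THE d. (v, d) \<in> ?P u) = ?d u" if "u \<in> set b" "admitted ?d k (set ys) u" for u
  proof -
    have "inj_on fst (?P u)" using search_sound(2) that(1) assms(5) by blast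
    then show ?thesis using found[OF that] by (rule the_snd_eq)
  qed
  have iff: "v \<in> fst ` ?P u \<longleftrightarrow> admitted ?d k (set ys) u" if "u \<in> set b" for u
    using adm[OF that] found[OF that] by force
  have "proposed G c k st b v =
    concat (map (\<lambda>u. if admitted ?d k (set ys) u then [(u, ?d u)] else []) b)"
    unfolding proposed_def using iff the by (intro arg_cong[of _ _ concat] map_cong) auto
  also have "\<dots> = map (\<lambda>u. (u, ?d u)) (filter (admitted ?d k (set ys)) b)"
    by (induction b) auto
  finally show ?thesis .
qed

text \<open>Holds for any monotone batch ends \<open>e\<close>. Soundness is carried along for all
  nodes \<open>w\<close>, because the searches of the next batch prune at all of them.\<close>

lemma run_batches_prefix:
  assumes xs: "distinct xs" "set xs \<subseteq> verts G" and "v \<in> verts G" "1 \<le> k"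
    and inj: "inj_on (sp_dist G c v) {h \<in> set xs. sp_dist G c v h < \<infinity>}"
    and e: "e 0 = 0" "mono e" "\<And>j. e j \<le> length xs"
  defines "st \<equiv> \<lambda>J. run_batches G c k (map (\<lambda>j. drop (e (j - 1)) (take (e j) xs)) [1..<Suc J])"
  shows "(\<forall>w. sound_entries G c w (set (take (e J) xs)) (fst (st J w))) \<and>
    fst (st J v) = prefix_sketch (sp_dist G c v) k (take (e J) xs) \<and>
    finite (snd (st J v)) \<and>
    card (snd (st J v)) \<le> (\<Sum>j<J. card {i \<in> {e j..<e (Suc j)}.
      admitted (sp_dist G c v) k (set (take (e j) xs)) (xs ! i) \<and>
      \<not> admitted (sp_dist G c v) k (set (take i xs)) (xs ! i)})"
proof (induction J)
  case 0
  then show ?case by (simp add: st_def run_batches_def e(1) sound_entries_def)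
next
  case (Suc J)
  let ?d = "sp_dist G c v" and ?b = "drop (e J) (take (e (Suc J)) xs)"
  have step: "st (Suc J) = run_batch G c k (st J) ?b"
    by (simp add: st_def run_batches_def)
  have le: "e J \<le> e (Suc J)" using e(2) by (simp add: mono_def)
  have split: "take (e (Suc J)) xs = take (e J) xs @ ?b"
    using le by (metis append_take_drop_id min_absorb1 take_take)
  have dist: "distinct (take (e J) xs @ ?b)" using xs(1) by (simp flip: split)
  have union: "set (take (e (Suc J)) xs) = set (take (e J) xs) \<union> set ?b"
    by (subst split) (rule set_append)
  have b: "set ?b \<subseteq> verts G" "set (take (e J) xs) \<union> set ?b \<subseteq> set xs"
    using xs(2) set_take_subset[of "e (Suc J)" xs] by (auto simp: union)
  have sound: "sound_entries G c w (set (take (e (Suc J)) xs)) (fst (st (Suc J) w))" for w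
    unfolding step union
    by (rule run_batch_sound) (use Suc.IH dist b in auto)
  have proposals: "proposed G c k (st J) ?b v = map (\<lambda>u. (u, ?d u)) (filter (admitted ?d k (set (take (e J) xs))) ?b)"
    by (rule proposed_exact)
      (use Suc.IH dist b assms(3,4) in \<open>auto intro: inj_on_subset[OF inj]\<close>)
  obtain X where X: "st J v = (prefix_sketch ?d k (take (e J) xs), X)"
    using Suc.IH by (cases "st J v") auto
  have "finite X" using Suc.IH X by simp
  then obtain X' where X': "foldl (insert_entry k) (st J v)
      (map (\<lambda>u. (u, ?d u)) (filter (admitted ?d k (set (take (e J) xs))) ?b)) =
      (prefix_sketch ?d k (take (e (Suc J)) xs), X')" "finite X'"
    "card X' \<le> card X + card {i \<in> {e J..<e (Suc J)}.
      admitted ?d k (set (take (e J) xs)) (xs ! i) \<and> \<not> admitted ?d k (set (take i xs)) (xs ! i)}"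
    using process_batch[OF xs(1) inj assms(4) le e(3)] unfolding X by blast
  have "st (Suc J) v = (prefix_sketch ?d k (take (e (Suc J)) xs), X')"
    unfolding step run_batch_def proposals X'(1) ..
  then show ?case using Suc.IH sound X X'(2,3) by simp
qed

end

section \<open>Expectations\<close>

text \<open>In the last claim, rounding up the next end costs the \<open>+ 1\<close>, and rounding
  up the current one only helps. The alternative \<open>batch_end mu k n j = n\<close> covers
  truncation.\<close>

lemma geometric_batch_ends:
  assumes "0 < mu" "1 \<le> k"
  shows "mono (batch_end mu k n)" "batch_end mu k n j \<le> n" "\<exists>J. batch_end mu k n J = n"
    "1 \<le> j \<Longrightarrow> real (batch_end mu k n (Suc j)) < (1 + mu) * real (batch_end mu k n j) + 1
      \<or> batch_end mu k n j = n"
proof -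
  show "mono (batch_end mu k n)"
  proof (rule monoI)
    fix i j :: nat assume "i \<le> j"
    then have "(1 + mu) ^ (i - 1) * real k \<le> (1 + mu) ^ (j - 1) * real k"
      using assms by (intro mult_right_mono power_increasing) auto
    then have "nat \<lceil>(1 + mu) ^ (i - 1) * real k\<rceil> \<le> nat \<lceil>(1 + mu) ^ (j - 1) * real k\<rceil>"
      by (intro nat_mono ceiling_mono)
    then have "min n (nat \<lceil>(1 + mu) ^ (i - 1) * real k\<rceil>) \<le> min n (nat \<lceil>(1 + mu) ^ (j - 1) * real k\<rceil>)"
      by (rule min.mono[OF order_refl])
    then show "batch_end mu k n i \<le> batch_end mu k n j"
      using \<open>i \<le> j\<close> by (simp only: batch_end_def split: if_split) auto
  qed
  show "batch_end mu k n j \<le> n" by (simp add: batch_end_def)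
  obtain m where m: "real n < (1 + mu) ^ m"
    using real_arch_pow[of "1 + mu" "real n"] assms by auto
  also have "\<dots> \<le> (1 + mu) ^ m * real k" using assms by simp
  finally have "n \<le> nat \<lceil>(1 + mu) ^ m * real k\<rceil>" by linarith
  then have "batch_end mu k n (Suc m) = n" by (simp add: batch_end_def)
  then show "\<exists>J. batch_end mu k n J = n" by blast
  assume j: "1 \<le> j"
  define x where "x = (1 + mu) ^ (j - 1) * real k"
  have x: "0 \<le> x" using assms by (simp add: x_def)
  have next_x: "(1 + mu) ^ (Suc j - 1) * real k = (1 + mu) * x"
    using j by (cases j) (auto simp: x_def)
  show "real (batch_end mu k n (Suc j)) < (1 + mu) * real (batch_end mu k n j) + 1 \<or> batch_end mu k n j = n"
  proof (cases "n \<le> nat \<lceil>x\<rceil>")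
    case True
    then show ?thesis using j by (simp add: batch_end_def x_def)
  next
    case False
    then have end_j: "batch_end mu k n j = nat \<lceil>x\<rceil>" using j by (simp add: batch_end_def x_def)
    have "real (batch_end mu k n (Suc j)) \<le> real (nat \<lceil>(1 + mu) * x\<rceil>)"
      using next_x by (simp add: batch_end_def)
    also have "\<dots> < (1 + mu) * x + 1"
    proof -
      have "0 \<le> (1 + mu) * x" using x assms by simp
      then show ?thesis by linarith
    qed
    also have "\<dots> \<le> (1 + mu) * real (nat \<lceil>x\<rceil>) + 1"
      using assms by (intro add_right_mono mult_left_mono real_nat_ceiling_ge) auto
    finally show ?thesis using end_j by simp
  qed
qed

text \<open>Up to the factor \<open>card (permutations_of_set U)\<close>, a probability for the
  rankee at position \<open>i\<close>, counted from 0: of being proposed if \<open>s\<close> is the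
  start of its batch, of being inserted if \<open>s = i\<close>.\<close>

definition admitted_count :: "('a \<Rightarrow> ereal) \<Rightarrow> nat \<Rightarrow> 'a set \<Rightarrow> nat \<Rightarrow> nat \<Rightarrow> real" where
  "admitted_count \<delta> k U s i =
     (\<Sum>xs\<in>permutations_of_set U. of_bool (admitted \<delta> k (set (take s xs)) (xs ! i)))"

text \<open>The element at position \<open>s\<close> may be swapped with any of its predecessors; summing over them
  counts the \<open>k\<close> closest of the first \<open>Suc s\<close> elements.\<close>

lemma admitted_count_diag:
  assumes "s < card U" "finite U" "inj_on \<delta> {u \<in> U. \<delta> u < \<infinity>}"
  shows "real (s + 1) * admitted_count \<delta> k U s s =
    (\<Sum>xs\<in>permutations_of_set U. real (min k (card {u \<in> set (take (Suc s) xs). \<delta> u < \<infinity>})))"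
proof -
  let ?P = "permutations_of_set U" and ?Y = "\<lambda>xs. set (take (Suc s) xs)"
  have "admitted_count \<delta> k U s s = (\<Sum>xs\<in>?P. of_bool (admitted \<delta> k (?Y xs) (xs ! s)))"
    unfolding admitted_count_def
  proof (intro sum.cong refl)
    fix xs assume "xs \<in> ?P"
    then have "s < length xs" using assms(1) length_finite_permutations_of_set by metis
    then have "take (Suc s) xs = take s xs @ [xs ! s]" by (rule take_Suc_conv_app_nth)
    \<comment> \<open>The additional element \<open>xs ! s\<close> is not strictly closer than
      itself.\<close>
    then have "{h \<in> ?Y xs. \<delta> h < \<delta> (xs ! s)} = {h \<in> set (take s xs). \<delta> h < \<delta> (xs ! s)}" by auto
    then show "of_bool (admitted \<delta> k (set (take s xs)) (xs ! s)) = of_bool (admitted \<delta> k (?Y xs) (xs ! s))"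
      by (simp add: admitted_def)
  qed
  then have "real (s + 1) * admitted_count \<delta> k U s s =
      (\<Sum>xs\<in>?P. \<Sum>u\<in>?Y xs. of_bool (admitted \<delta> k (?Y xs) u))"
    using sum_permutations_nth_within[OF assms(1), of "\<lambda>Y u. of_bool (admitted \<delta> k Y u)"] by simp
  also have "\<dots> = (\<Sum>xs\<in>?P. real (min k (card {u \<in> ?Y xs. \<delta> u < \<infinity>})))"
  proof (intro sum.cong refl)
    fix xs assume "xs \<in> ?P"
    then have "?Y xs \<subseteq> U" using set_take_subset permutations_of_setD(1) by metis
    then have "inj_on \<delta> {u \<in> ?Y xs. \<delta> u < \<infinity>}" by (intro inj_on_subset[OF assms(3)]) auto
    then have "card {u \<in> ?Y xs. admitted \<delta> k (?Y xs) u} = min k (card {u \<in> ?Y xs. \<delta> u < \<infinity>})"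
      by (intro card_admitted) auto
    moreover have "?Y xs \<inter> {u. admitted \<delta> k (?Y xs) u} = {u \<in> ?Y xs. admitted \<delta> k (?Y xs) u}" by auto
    ultimately show "(\<Sum>u\<in>?Y xs. of_bool (admitted \<delta> k (?Y xs) u)) =
        real (min k (card {u \<in> ?Y xs. \<delta> u < \<infinity>}))"
      by (simp add: sum_of_bool_eq)
  qed
  finally show ?thesis .
qed

lemma admitted_count_diag_mono:
  assumes "s \<le> i" "i < card U" "finite U" "inj_on \<delta> {u \<in> U. \<delta> u < \<infinity>}"
  shows "real (s + 1) * admitted_count \<delta> k U s s \<le> real (i + 1) * admitted_count \<delta> k U i i"
proof -
  have "card {u \<in> set (take (Suc s) xs). \<delta> u < \<infinity>} \<le> card {u \<in> set (take (Suc i) xs). \<delta> u < \<infinity>}" for xs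
    using set_take_subset_set_take[of "Suc s" "Suc i" xs] assms(1) by (intro card_mono) auto
  then show ?thesis
    using assms by (subst (1 2) admitted_count_diag) (auto intro!: sum_mono simp: min.coboundedI2)
qed

lemma admitted_count_beyond:
  assumes "s \<le> i" "i < card U"
  shows "admitted_count \<delta> k U s i = admitted_count \<delta> k U s s"
  unfolding admitted_count_def
  by (rule sum_permutations_nth_beyond[OF assms, where f = "\<lambda>Y u. of_bool (admitted \<delta> k Y u)"])

text \<open>With the common numerator \<open>B\<close>, each position contributes
  \<open>B / (s + 1)\<close> on the left, and by monotonicity at least \<open>B / (i + 1)\<close> to
  the sum on the right. What remains is \<open>batch_overhead\<close> with
  \<open>p = e - s\<close>.\<close>

lemma admitted_count_batch:
  assumes "finite U" "inj_on \<delta> {u \<in> U. \<delta> u < \<infinity>}" "0 < mu"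
    and "1 \<le> s" "s \<le> e" "e \<le> card U" "real e < (1 + mu) * real s + 1"
  shows "(\<Sum>i\<in>{s..<e}. admitted_count \<delta> k U s i) \<le>
    mu / ln (1 + mu) * (\<Sum>i\<in>{s..<e}. admitted_count \<delta> k U i i)"
proof (cases "s = e")
  case False
  let ?C = "mu / ln (1 + mu)"
  define B where "B = real (s + 1) * admitted_count \<delta> k U s s"
  have B: "0 \<le> B" by (auto simp: B_def admitted_count_def intro!: mult_nonneg_nonneg sum_nonneg)
  have C: "0 \<le> ?C" using assms(3) by simp
  have "(\<Sum>i\<in>{s..<e}. admitted_count \<delta> k U s i) = (\<Sum>i\<in>{s..<e}. B / real (s + 1))"
  proof (intro sum.cong refl)
    fix i assume "i \<in> {s..<e}"
    then have "admitted_count \<delta> k U s i = admitted_count \<delta> k U s s"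
      using assms(6) by (intro admitted_count_beyond) auto
    then show "admitted_count \<delta> k U s i = B / real (s + 1)" by (simp add: B_def)
  qed
  also have "\<dots> = B * (real (e - s) / real (s + 1))" by simp
  also have "\<dots> \<le> B * (?C * (\<Sum>i\<in>{s..<s + (e - s)}. 1 / real (i + 1)))"
    using assms B by (intro mult_left_mono batch_overhead) (auto simp: of_nat_diff algebra_simps)
  also have "\<dots> = ?C * (\<Sum>i\<in>{s..<e}. B / real (i + 1))"
    using assms(5) by (simp add: sum_distrib_left mult_ac)
  also have "\<dots> \<le> ?C * (\<Sum>i\<in>{s..<e}. admitted_count \<delta> k U i i)"
  proof (intro mult_left_mono[OF _ C] sum_mono)
    fix i assume "i \<in> {s..<e}"
    then have "B \<le> real (i + 1) * admitted_count \<delta> k U i i"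
      unfolding B_def using assms by (intro admitted_count_diag_mono) auto
    then show "B / real (i + 1) \<le> admitted_count \<delta> k U i i" by (simp add: divide_le_eq mult.commute)
  qed
  finally show ?thesis .
qed simp

text \<open>Admission against the longer prefix implies admission against the shorter one, so the
  difference of indicators is itself an indicator.\<close>

lemma card_late_eq_sum:
  "real (card {i \<in> {s..<e}. admitted \<delta> k (set (take s xs)) (xs ! i) \<and> \<not> admitted \<delta> k (set (take i xs)) (xs ! i)}) =
    (\<Sum>i\<in>{s..<e}. of_bool (admitted \<delta> k (set (take s xs)) (xs ! i)) - of_bool (admitted \<delta> k (set (take i xs)) (xs ! i)))"
  (is "real (card ?L) = _")
proof -
  have "real (card ?L) = (\<Sum>i\<in>{s..<e}. of_bool (admitted \<delta> k (set (take s xs)) (xs ! i) \<and>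
      \<not> admitted \<delta> k (set (take i xs)) (xs ! i)))"
    by (simp add: sum_of_bool_eq Int_def)
  also have "\<dots> = (\<Sum>i\<in>{s..<e}. of_bool (admitted \<delta> k (set (take s xs)) (xs ! i)) - of_bool (admitted \<delta> k (set (take i xs)) (xs ! i)))"
  proof (intro sum.cong refl)
    fix i assume "i \<in> {s..<e}"
    then have "admitted \<delta> k (set (take i xs)) (xs ! i) \<Longrightarrow> admitted \<delta> k (set (take s xs)) (xs ! i)"
      by (intro admitted_antimono[of "set (take i xs)" "set (take s xs)"]) (auto intro: set_take_subset_set_take[THEN subsetD])
    then show "of_bool (admitted \<delta> k (set (take s xs)) (xs ! i) \<and> \<not> admitted \<delta> k (set (take i xs)) (xs ! i)) =
      (of_bool (admitted \<delta> k (set (take s xs)) (xs ! i)) - of_bool (admitted \<delta> k (set (take i xs)) (xs ! i)) :: real)"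
      by auto
  qed
  finally show ?thesis .
qed

lemma sum_batches:
  fixes f :: "nat \<Rightarrow> real"
  assumes "mono e" "e 0 = 0"
  shows "(\<Sum>j<J. \<Sum>i\<in>{e j..<e (Suc j)}. f i) = (\<Sum>i<e J. f i)"
proof (induction J)
  case (Suc J)
  have "e J \<le> e (Suc J)" using assms(1) by (simp add: mono_def)
  then have "(\<Sum>i<e (Suc J). f i) = (\<Sum>i<e J. f i) + (\<Sum>i\<in>{e J..<e (Suc J)}. f i)"
    unfolding lessThan_atLeast0 by (intro sum.atLeastLessThan_concat[symmetric]) auto
  then show ?case using Suc.IH by (simp only: sum.lessThan_Suc)
qed (simp add: assms)

theorem lemma3p1:
  fixes G :: "('a, 'b) pre_digraph" and c :: "'b \<Rightarrow> real"
    and U :: "'a set" and k :: nat and mu :: real and v :: 'a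
  assumes "fin_digraph G"
    and "\<And>a. a \<in> arcs G \<Longrightarrow> 0 < c a"
    and "U \<subseteq> verts G"
    and "1 \<le> k"
    and "0 < mu"
    and "v \<in> verts G"
    and "distinct_dists G c U v"
  shows "overhead G c U k mu v \<le> mu / ln (1 + mu) - 1"
proof -
  let ?d = "sp_dist G c v" and ?C = "mu / ln (1 + mu)" and ?P = "permutations_of_set U"
  let ?Q = "admitted_count ?d k U"
  have finU: "finite U" using assms(1,3) fin_digraph.finite_verts finite_subset by blast
  have inj: "inj_on ?d {u \<in> U. ?d u < \<infinity>}" using assms(7) by (simp add: distinct_dists_def)
  define n where "n = card U"
  define e where "e = batch_end mu k n"
  define J where "J = (LEAST J. e J = n)"
  have e: "mono e" "e 0 = 0" "e J = n" "\<And>j. e j \<le> n"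
    using geometric_batch_ends[OF assms(5,4), of n] LeastI_ex[of "\<lambda>J. e J = n"]
    by (auto simp: e_def J_def batch_end_def)
  have xs: "set xs = U" "distinct xs" "length xs = n" if "xs \<in> ?P" for xs
    using that by (auto simp: n_def dest: permutations_of_setD length_finite_permutations_of_set)
  \<comment> \<open>Makes the claimed bound nonnegative, as required for the first batch and for an
    empty expected sketch.\<close>
  have C: "1 \<le> ?C" using assms(5) ln_add_one_self_le_self[of mu] by (simp add: le_divide_eq)

  have "(\<Sum>xs\<in>?P. real (card (discarded G c k mu xs v))) \<le>
    (\<Sum>xs\<in>?P. \<Sum>j<J. \<Sum>i\<in>{e j..<e (Suc j)}. of_bool (admitted ?d k (set (take (e j) xs)) (xs ! i)) -
      of_bool (admitted ?d k (set (take i xs)) (xs ! i)))"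
  proof (rule sum_mono)
    fix xs assume "xs \<in> ?P"
    note xs = xs[OF this]
    have "card (discarded G c k mu xs v) \<le> (\<Sum>j<J. card {i \<in> {e j..<e (Suc j)}.
      admitted ?d k (set (take (e j) xs)) (xs ! i) \<and> \<not> admitted ?d k (set (take i xs)) (xs ! i)})"
      unfolding discarded_def geometric_batches_def Let_def xs(3) e_def[symmetric] J_def[symmetric]
      using run_batches_prefix[of G c xs v k e J] assms xs inj e by blast
    then have "real (card (discarded G c k mu xs v)) \<le> (\<Sum>j<J. real (card {i \<in> {e j..<e (Suc j)}.
      admitted ?d k (set (take (e j) xs)) (xs ! i) \<and> \<not> admitted ?d k (set (take i xs)) (xs ! i)}))"
      by (simp only: of_nat_sum[symmetric] of_nat_le_iff)
    then show "real (card (discarded G c k mu xs v)) \<le> (\<Sum>j<J. \<Sum>i\<in>{e j..<e (Suc j)}.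
      of_bool (admitted ?d k (set (take (e j) xs)) (xs ! i)) - of_bool (admitted ?d k (set (take i xs)) (xs ! i)))"
      by (simp only: card_late_eq_sum)
  qed
  also have "\<dots> = (\<Sum>j<J. \<Sum>i\<in>{e j..<e (Suc j)}. ?Q (e j) i - ?Q i i)"
    unfolding admitted_count_def
    by (subst sum.swap, rule sum.cong[OF refl], subst sum.swap) (simp add: sum_subtractf)
  also have "\<dots> \<le> (\<Sum>j<J. \<Sum>i\<in>{e j..<e (Suc j)}. (?C - 1) * ?Q i i)"
  proof (rule sum_mono)
    fix j
    have Q: "0 \<le> ?Q i i" for i by (auto simp: admitted_count_def intro!: sum_nonneg)
    have le: "e j \<le> e (Suc j)" using e(1) by (simp add: mono_def)
    show "(\<Sum>i\<in>{e j..<e (Suc j)}. ?Q (e j) i - ?Q i i) \<le> (\<Sum>i\<in>{e j..<e (Suc j)}. (?C - 1) * ?Q i i)"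
    proof (cases "j = 0")
      case True
      show ?thesis
      proof (rule sum_mono)
        fix i assume "i \<in> {e j..<e (Suc j)}"
        \<comment> \<open>The first batch ends at \<open>min n k\<close>, since the exponent is 0
          there.\<close>
        then have i: "i < k" using True by (simp add: e_def batch_end_def)
        have "card {h \<in> set (take i xs). ?d h < ?d u} < k" for xs u
        proof -
          have "card {h \<in> set (take i xs). ?d h < ?d u} \<le> card (set (take i xs))" by (intro card_mono) auto
          also have "\<dots> \<le> i" using card_length[of "take i xs"] by simp
          finally show ?thesis using i by simp
        qed
        then have "?Q (e j) i = ?Q i i"
          using True e(2) assms(4) by (simp add: admitted_count_def admitted_def)
        moreover have "0 \<le> (?C - 1) * ?Q i i" using C Q by (intro mult_nonneg_nonneg) auto
        ultimately show "?Q (e j) i - ?Q i i \<le> (?C - 1) * ?Q i i" by simp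
      qed
    next
      case False
      show ?thesis
      \<comment> \<open>After truncation the growth bound may fail, but the batch is empty.\<close>
      proof (cases "e j = n")
        case True
        then have "{e j..<e (Suc j)} = {}" using e(4)[of "Suc j"] by simp
        then show ?thesis by simp
      next
        case neq: False
        have "1 \<le> nat \<lceil>(1 + mu) ^ (j - 1) * real k\<rceil>"
        proof -
          have "0 < (1 + mu) ^ (j - 1) * real k" using assms(4,5) by simp
          then show ?thesis by linarith
        qed
        then have "1 \<le> e j" using neq False by (auto simp: e_def batch_end_def min_def split: if_splits)
        moreover have "real (e (Suc j)) < (1 + mu) * real (e j) + 1"
          using geometric_batch_ends(4)[OF assms(5,4), of j n] False neq by (auto simp: e_def)
        ultimately have "(\<Sum>i\<in>{e j..<e (Suc j)}. ?Q (e j) i) \<le> ?C * (\<Sum>i\<in>{e j..<e (Suc j)}. ?Q i i)"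
          using le e(4) by (intro admitted_count_batch finU inj assms(5)) (auto simp: n_def)
        then show ?thesis by (simp add: sum_subtractf left_diff_distrib sum_distrib_left)
      qed
    qed
  qed
  also have "\<dots> = (?C - 1) * (\<Sum>i<n. ?Q i i)"
    using e by (simp add: sum_batches sum_distrib_left)
  also have "(\<Sum>i<n. ?Q i i) = (\<Sum>xs\<in>?P. real (card (ADS G c U k (rank_val xs) v)))"
    unfolding admitted_count_def
  proof (subst sum.swap, rule sum.cong[OF refl])
    fix xs assume perm: "xs \<in> ?P"
    note xs = xs[OF perm]
    have "card (ADS G c U k (rank_val xs) v) = card {i. i < n \<and> admitted ?d k (set (take i xs)) (xs ! i)}"
      using ADS_eq_prefix_sketch[OF perm assms(4,7)] card_prefix_sketch[OF xs(2), of ?d k] xs(3) by simp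
    then show "(\<Sum>i<n. of_bool (admitted ?d k (set (take i xs)) (xs ! i))) = real (card (ADS G c U k (rank_val xs) v))"
      by (simp add: sum_of_bool_eq Int_def)
  qed
  finally have main: "(\<Sum>xs\<in>?P. real (card (discarded G c k mu xs v))) \<le>
    (?C - 1) * (\<Sum>xs\<in>?P. real (card (ADS G c U k (rank_val xs) v)))" .

  have P: "?P \<noteq> {}" "finite ?P" using finU by auto
  have cardP: "real (card ?P) > 0" using P by (simp add: card_gt_0_iff)
  have "overhead G c U k mu v = (\<Sum>xs\<in>?P. real (card (discarded G c k mu xs v))) /
    (\<Sum>xs\<in>?P. real (card (ADS G c U k (rank_val xs) v)))"
    unfolding overhead_def integral_pmf_of_set[OF P] using cardP finU by simp
  moreover have "0 \<le> (\<Sum>xs\<in>?P. real (card (ADS G c U k (rank_val xs) v)))" by (intro sum_nonneg) auto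
  \<comment> \<open>If the denominator is 0, the quotient is 0 by convention and the bound is
    nonnegative by \<open>C\<close>.\<close>
  ultimately show ?thesis
    using main C by (cases "(\<Sum>xs\<in>?P. real (card (ADS G c U k (rank_val xs) v))) = 0")
      (auto simp: divide_le_eq)
qed

end
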